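(* Let $1<p<\infty$, let $f:\mathbb{R}_+\times\mathbb{R}\to\mathbb{R}_+$ be continuous, and let $0<r<R<\infty$. Assume: (H1) for each $x\in\mathbb{R}_+$ the function $f(x,\cdot)$ is decreasing on $\mathbb{R}_+$; for each $y\in\mathbb{R}$ the function $f(\cdot,y)$ is increasing on $\mathbb{R}_+$; and $f(x,y)=f(x,-y)$ for all $x\in\mathbb{R}_+$, $y\in\mathbb{R}$ (monotonicity here is not necessarily strict). (H2) with $f_0(x)=f(x,0)$ and $f_\infty(x)=\lim_{y\to\infty}f(x,y)$, one has $$f_0(r)<\frac{r^{p-1}}{c_p}\quad\text{and}\quad f_\infty(R\phi(\beta))>\frac{R^{p-1}}{2\Phi},$$ where $\beta\in(0,\frac12)$ is a fixed number and $\Phi=\int_\beta^{1/2}\phi(s)\,ds$. (H3) for each $x\in(0,\infty)$ and $y\in\mathbb{R}$, the mapping $t\mapsto\frac{f(tx,ty)}{t^{p-1}}$ is strictly increasing on $(0,R]$. Then the problem $$-\left(|u'|^{p-2}u'\right)'(t)=f(u(t),u'(t)),\ t\in(0,1),\qquad u\ge0,\qquad u(0)=u(1)=0,$$ admits a solution $u\in K$ with $r<|u|_{1,p}<R$. Moreover, for $v=\frac{u}{|u|_{1,p}}$, $u$ maximizes the energy function $\mathcal{E}(v)$ on $(r,R)$ along its own direction, i.e. $\mathcal{E}(v)$ attains its maximum on $(r,R)$ at $t=|u|_{1,p}$.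
   Context: $W_0^{1,p}(0,1)$ is endowed with the norm $|u|_{1,p}=\left(\int_0^1|u'|^p\,dx\right)^{1/p}$, and $|w|_p=\left(\int_0^1|w|^p\,dx\right)^{1/p}$. $q$ is the conjugate exponent of $p$. $c_p$ is the smallest constant such that $|u|_p\le c_p|u|_{1,p}$ for all $u\in W_0^{1,p}(0,1)$. The function $\phi:[0,1/2]\to\mathbb{R}_+$ is $\phi(t)=\int_0^t(1-2s)^{\frac1{p-1}}ds$. The cone is $$K=\{u\in W_0^{1,p}(0,1): u\ge0,\ u\text{ concave},\ u(t)=u(1-t),\ u(t)\ge\phi(t)|u|_{1,p}\text{ for all }t\in[0,1/2]\}.$$ $J:W_0^{1,p}(0,1)\to W^{-1,q}(0,1)$ (the dual space), $Ju=-(|u'|^{p-2}u')'$, is the (bijective) duality mapping for the normalization function $\theta(t)=t^{p-1}$. A solution of the problem means $u\in W_0^{1,p}(0,1)$, $u\ge 0$, with $Ju=f(u,u')$ in $W^{-1,q}(0,1)$, equivalently $u=T(u)$ with $T(u)=J^{-1}(f(u,u'))$. For $v\in K$ with $|v|_{1,p}=1$ and $t>0$, $$\mathcal{E}(v)(t)=\int_0^t\langle J(sv)-J(T(sv)),v\rangle\,ds=\int_0^t\left(s^{p-1}-\int_0^1f(sv(\tau),sv'(\tau))v(\tau)\,d\tau\right)ds.$$ *)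

theory Defs
  imports "HOL-Analysis.Analysis"
begin

abbreviation I01 :: "real measure" where
  "I01 \<equiv> lebesgue_on {0<..<1}"

definition Lp :: "real \<Rightarrow> (real \<Rightarrow> real) set" where
  "Lp p = {w \<in> borel_measurable I01. integrable I01 (\<lambda>x. \<bar>w x\<bar> powr p)}"

definition Lp_norm :: "real \<Rightarrow> (real \<Rightarrow> real) \<Rightarrow> real" where
  "Lp_norm p w = (LINT x|I01. \<bar>w x\<bar> powr p) powr (1 / p)"

definition Cc1 :: "(real \<Rightarrow> real) set" where
  "Cc1 = {\<psi>. \<psi> C1_differentiable_on UNIV \<and> closure {x. \<psi> x \<noteq> 0} \<subseteq> {0<..<1}}"

definition has_weak_deriv :: "(real \<Rightarrow> real) \<Rightarrow> (real \<Rightarrow> real) \<Rightarrow> bool" where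
  "has_weak_deriv u g \<longleftrightarrow> integrable I01 u \<and> integrable I01 g \<and>
     (\<forall>\<psi>\<in>Cc1. (LINT x|I01. u x * deriv \<psi> x) = - (LINT x|I01. g x * \<psi> x))"

text \<open>The weak derivative is determined only almost everywhere on (0,1); all the notions below
  depend only on its almost-everywhere class.\<close>

definition wderiv :: "(real \<Rightarrow> real) \<Rightarrow> real \<Rightarrow> real" where
  "wderiv u = (SOME g. has_weak_deriv u g)"

definition W1p :: "real \<Rightarrow> (real \<Rightarrow> real) set" where
  "W1p p = {u \<in> Lp p. \<exists>g\<in>Lp p. has_weak_deriv u g}"

definition W1p_norm :: "real \<Rightarrow> (real \<Rightarrow> real) \<Rightarrow> real" where
  "W1p_norm p u = Lp_norm p u + Lp_norm p (wderiv u)"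

text \<open>The closure of \<open>Cc1\<close> in \<open>W1p p\<close> (as in Brezis' treatment of Sobolev spaces on an interval),
  each class being represented by its representative that is continuous on [0,1]. Values outside
  [0,1] are irrelevant.\<close>

definition W01p :: "real \<Rightarrow> (real \<Rightarrow> real) set" where
  "W01p p = {u \<in> W1p p. continuous_on {0..1} u \<and>
     (\<exists>\<psi>. (\<forall>n::nat. \<psi> n \<in> Cc1) \<and> (\<lambda>n. W1p_norm p (\<lambda>x. u x - \<psi> n x)) \<longlonglongrightarrow> 0)}"

definition W01p_norm :: "real \<Rightarrow> (real \<Rightarrow> real) \<Rightarrow> real" where
  "W01p_norm p u = Lp_norm p (wderiv u)"

definition poincare_const :: "real \<Rightarrow> real" where
  "poincare_const p = (LEAST c. \<forall>u\<in>W01p p. Lp_norm p u \<le> c * W01p_norm p u)"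

definition phi :: "real \<Rightarrow> real \<Rightarrow> real" where
  "phi p t = integral {0..t} (\<lambda>s. (1 - 2 * s) powr (1 / (p - 1)))"

definition coneK :: "real \<Rightarrow> (real \<Rightarrow> real) set" where
  "coneK p = {u \<in> W01p p. (\<forall>t\<in>{0..1}. 0 \<le> u t) \<and> concave_on {0..1} u \<and>
     (\<forall>t\<in>{0..1}. u t = u (1 - t)) \<and> (\<forall>t\<in>{0..1/2}. phi p t * W01p_norm p u \<le> u t)}"

text \<open>The functional \<open>-(\<bar>u'\<bar>\<^sup>p\<^sup>-\<^sup>2 u')'\<close> on \<open>W01p p\<close>.
  Where \<open>u' = 0\<close> the integrand is 0, also when \<open>p < 2\<close>.\<close>

definition duality_map :: "real \<Rightarrow> (real \<Rightarrow> real) \<Rightarrow> (real \<Rightarrow> real) \<Rightarrow> real" where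
  "duality_map p u w = (LINT x|I01. \<bar>wderiv u x\<bar> powr (p - 2) * wderiv u x * wderiv w x)"

text \<open>Equality in the dual space is equality of functionals on \<open>W01p p\<close>. The integrability clause
  says that \<open>f(u,u')\<close> induces such a functional; its boundedness then follows from the equation.\<close>

definition is_solution ::
    "real \<Rightarrow> (real \<Rightarrow> real \<Rightarrow> real) \<Rightarrow> (real \<Rightarrow> real) \<Rightarrow> bool" where
  "is_solution p f u \<longleftrightarrow> u \<in> W01p p \<and> (\<forall>t\<in>{0..1}. 0 \<le> u t) \<and> u 0 = 0 \<and> u 1 = 0 \<and>
     (\<forall>w\<in>W01p p. integrable I01 (\<lambda>x. f (u x) (wderiv u x) * w x) \<and>
        duality_map p u w = (LINT x|I01. f (u x) (wderiv u x) * w x))"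

text \<open>The primitive of \<open>\<langle>J(sv) - J(T(sv)), v\<rangle>\<close> for \<open>v\<close> of norm 1, where
  \<open>J = duality_map p\<close> and \<open>T w = J\<^sup>-\<^sup>1(f(w,w'))\<close>:
  here \<open>\<langle>J(sv), v\<rangle> = s powr (p - 1)\<close>.\<close>

definition energy ::
    "real \<Rightarrow> (real \<Rightarrow> real \<Rightarrow> real) \<Rightarrow> (real \<Rightarrow> real) \<Rightarrow> real \<Rightarrow> real" where
  "energy p f v t = integral {0..t}
     (\<lambda>s. s powr (p - 1) - (LINT x|I01. f (s * v x) (s * wderiv v x) * v x))"

definition f_zero :: "(real \<Rightarrow> real \<Rightarrow> real) \<Rightarrow> real \<Rightarrow> real" where
  "f_zero f x = f x 0"

definition f_infty :: "(real \<Rightarrow> real \<Rightarrow> real) \<Rightarrow> real \<Rightarrow> real" where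
  "f_infty f x = Lim at_top (\<lambda>y. f x y)"

end

theory Submission
  imports Defs "HOL-Complex_Analysis.Great_Picard"
begin

text \<open>The proof replaces the fixed point argument by shooting. Put \<open>z = |u'|\<^sup>p\<^sup>-\<^sup>2 u'\<close> and solve, on \<open>[0, 1/2]\<close>,
  \<open>u(0) = 0\<close>, \<open>z(0) = a\<^sup>p\<^sup>-\<^sup>1\<close>, \<open>u' = max(0, z)\<^sup>1\<^sup>/\<^sup>(\<^sup>p\<^sup>-\<^sup>1\<^sup>)\<close>, \<open>z' = -f(u, u')\<close>. If \<open>z(1/2) = 0\<close>, the even
  reflection of \<open>u\<close> about \<open>1/2\<close> solves the problem. Since \<open>f\<close> is merely continuous, solutions need not
  be unique; one therefore takes solutions of a delayed equation, which depend continuously on \<open>a\<close>,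
  applies the intermediate value theorem to them and passes to the limit by Arzela-Ascoli.

  The two signs of \<open>z(1/2)\<close> are excluded at the ends of the range of \<open>a\<close> by testing the equation with
  \<open>u\<close>: with \<open>N\<^sup>p = 2 \<integral> |u'|\<^sup>p\<close> over \<open>[0, 1/2]\<close>, the identity \<open>N\<^sup>p / 2 = z(1/2) u(1/2) + \<integral> f(u, u') u\<close> and
  (H2) give \<open>N < R\<close> if \<open>z(1/2) \<ge> 0\<close>, and \<open>u(1/2) > r\<close> (hence \<open>a \<ge> N > r\<close>) if \<open>z(1/2) \<le> 0\<close>. Both use that (H3)
  holds on all of \<open>(0, \<infinity>)\<close>, because \<open>x\<close> and \<open>y\<close> can be rescaled. Finally, (H3) shows that the derivative
  of the energy along the ray through \<open>u\<close> changes its sign from plus to minus at \<open>N\<close>.\<close>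

section \<open>Weak derivatives and Sobolev functions on the unit interval\<close>

lemma max_0_square_deriv: "((\<lambda>s::real. (max 0 s)\<^sup>2) has_real_derivative 2 * max 0 s) (at s)"
proof -
  consider "s > 0" | "s < 0" | "s = 0" by linarith
  then show ?thesis
  proof cases
    case 1
    have "((\<lambda>s. s\<^sup>2) has_real_derivative 2 * max 0 s) (at s)"
      using 1 by (auto intro!: derivative_eq_intros)
    then show ?thesis
      by (rule has_field_derivative_transform_within_open[where S="{0<..}"]) (use 1 in auto)
  next
    case 2
    have "((\<lambda>s. 0) has_real_derivative 2 * max 0 s) (at s)"
      using 2 by (auto intro!: derivative_eq_intros)
    then show ?thesis
      by (rule has_field_derivative_transform_within_open[where S="{..<0}"]) (use 2 in auto)
  next
    case 3
    \<comment> \<open>Squaring removes the kink of \<open>max 0\<close>: at \<open>0\<close> the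
      difference quotient is bounded by \<open>\<bar>h\<bar>\<close>.\<close>
    have "(\<lambda>h::real. ((max 0 h)\<^sup>2) / h) \<midarrow>0\<rightarrow> 0"
    proof (rule Lim_null_comparison)
      show "\<forall>\<^sub>F h in at (0::real). norm ((max 0 h)\<^sup>2 / h) \<le> \<bar>h\<bar>"
        by (rule always_eventually) (auto simp: max_def power2_eq_square)
      show "(\<lambda>h::real. \<bar>h\<bar>) \<midarrow>0\<rightarrow> 0"
        by (rule tendsto_eq_intros refl | simp)+
    qed
    then show ?thesis using 3 by (simp add: DERIV_def)
  qed
qed

text \<open>A continuously differentiable approximation of \<open>max 0\<close> that vanishes on \<open>{..e}\<close>: composed with a
  function that is positive only inside \<open>(0,1)\<close> it yields an element of \<open>Cc1\<close>.\<close>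

definition trunc :: "real \<Rightarrow> real \<Rightarrow> real" where
  "trunc e s = sqrt ((max 0 (s - e))\<^sup>2 + e\<^sup>2) - e"

definition trunc' :: "real \<Rightarrow> real \<Rightarrow> real" where
  "trunc' e s = max 0 (s - e) / sqrt ((max 0 (s - e))\<^sup>2 + e\<^sup>2)"

lemma trunc_radicand_pos: "e > 0 \<Longrightarrow> (max 0 (s - e))\<^sup>2 + e\<^sup>2 > (0::real)"
  by (simp add: add_nonneg_pos)

lemma trunc_deriv:
  assumes "e > 0"
  shows "(trunc e has_real_derivative trunc' e s) (at s)"
proof -
  have 1: "((\<lambda>s. (max 0 (s - e))\<^sup>2) has_real_derivative 2 * max 0 (s - e)) (at s)"
    by (rule DERIV_chain'[where g="\<lambda>s. (max 0 s)\<^sup>2" and E="2 * max 0 (s - e)" and D=1, THEN DERIV_cong])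
       (auto intro!: derivative_eq_intros max_0_square_deriv)
  define h where "h s = (max 0 (s - e))\<^sup>2 + e\<^sup>2" for s
  have "(h has_real_derivative 2 * max 0 (s - e)) (at s)"
    unfolding h_def[abs_def] using DERIV_add[OF 1 DERIV_const] by simp
  moreover have "h s > 0" using trunc_radicand_pos[OF assms] by (simp add: h_def)
  ultimately have "((\<lambda>s. sqrt (h s) - e) has_real_derivative max 0 (s - e) / sqrt (h s)) (at s)"
    by (auto intro!: derivative_eq_intros simp: field_simps)
  then show ?thesis unfolding trunc_def[abs_def] trunc'_def h_def .
qed

lemma trunc_eq_0: "e > 0 \<Longrightarrow> s \<le> e \<Longrightarrow> trunc e s = 0"
  by (simp add: trunc_def)

text \<open>The root lies between \<open>m\<close> and \<open>m + e\<close>, where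
  \<open>m = max 0 (s - e)\<close>, and \<open>m\<close> itself lies at most \<open>e\<close> below
  \<open>s\<close>; the two errors add up.\<close>

lemma trunc_approx:
  assumes "e > 0" "s \<ge> 0"
  shows "\<bar>s - trunc e s\<bar> \<le> 2 * e"
proof -
  let ?m = "max 0 (s - e)"
  have "sqrt (?m\<^sup>2 + e\<^sup>2) \<ge> ?m"
    by (rule real_le_rsqrt) simp
  moreover have "sqrt (?m\<^sup>2 + e\<^sup>2) \<le> ?m + e"
    by (rule real_le_lsqrt) (use assms in \<open>auto simp: power2_sum\<close>)
  moreover have "sqrt (?m\<^sup>2 + e\<^sup>2) \<ge> e"
    by (rule real_le_rsqrt) simp
  ultimately have "?m - e \<le> trunc e s" "trunc e s \<le> ?m" unfolding trunc_def by linarith+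
  then show ?thesis using assms by linarith
qed

lemma trunc'_bounds:
  assumes "e > 0"
  shows "0 \<le> trunc' e s" "trunc' e s \<le> 1"
proof -
  have "sqrt ((max 0 (s - e))\<^sup>2 + e\<^sup>2) \<ge> max 0 (s - e)"
    by (rule real_le_rsqrt) simp
  then show "trunc' e s \<le> 1"
    unfolding trunc'_def using trunc_radicand_pos[OF assms, of s] by (subst divide_le_eq_1) auto
qed (simp add: trunc'_def)

lemma trunc'_cont: "e > 0 \<Longrightarrow> continuous_on S (trunc' e)"
  unfolding trunc'_def[abs_def]
  by (intro continuous_intros) (metis less_irrefl real_sqrt_eq_0_iff trunc_radicand_pos)

lemma trunc'_tendsto:
  assumes "s > 0"
  shows "(\<lambda>n. trunc' (1 / real (Suc n)) s) \<longlonglongrightarrow> 1"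
proof -
  have 0: "(\<lambda>n. 1 / real (Suc n)) \<longlonglongrightarrow> 0"
    using LIMSEQ_inverse_real_of_nat by (simp add: inverse_eq_divide)
  have "(\<lambda>n. trunc' (1 / real (Suc n)) s) \<longlonglongrightarrow> max 0 (s - 0) / sqrt ((max 0 (s - 0))\<^sup>2 + 0\<^sup>2)"
    unfolding trunc'_def by (intro tendsto_intros 0) (use assms in auto)
  then show ?thesis using assms by simp
qed

lemma trunc_tendsto:
  assumes "s \<ge> 0"
  shows "(\<lambda>n. trunc (1 / real (Suc n)) s) \<longlonglongrightarrow> s"
proof -
  have 0: "(\<lambda>n. 1 / real (Suc n)) \<longlonglongrightarrow> 0"
    using LIMSEQ_inverse_real_of_nat by (simp add: inverse_eq_divide)
  have "(\<lambda>n. trunc (1 / real (Suc n)) s) \<longlonglongrightarrow> sqrt ((max 0 (s - 0))\<^sup>2 + 0\<^sup>2) - 0"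
    unfolding trunc_def by (intro tendsto_intros 0)
  then show ?thesis using assms by simp
qed

lemma Cc1_I:
  assumes "\<And>x. (\<psi> has_real_derivative \<psi>' x) (at x)" "continuous_on UNIV \<psi>'"
    and "closed C" "C \<subseteq> {0<..<1}" "\<And>x. x \<notin> C \<Longrightarrow> \<psi> x = 0"
  shows "\<psi> \<in> Cc1"
proof -
  have "closure {x. \<psi> x \<noteq> 0} \<subseteq> C"
    by (rule closure_minimal) (use assms in auto)
  then show ?thesis
    unfolding Cc1_def C1_differentiable_on_def
    using assms by (auto simp: has_real_derivative_iff_has_vector_derivative)
qed

lemma Cc1_D:
  assumes "\<psi> \<in> Cc1"
  shows "(\<psi> has_real_derivative deriv \<psi> x) (at x)" "continuous_on UNIV (deriv \<psi>)"
    "continuous_on UNIV \<psi>" "x \<notin> {0<..<1} \<Longrightarrow> \<psi> x = 0"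
proof -
  obtain D where D: "\<And>x. (\<psi> has_real_derivative D x) (at x)" "continuous_on UNIV D"
    using assms unfolding Cc1_def C1_differentiable_on_def
    by (auto simp: has_real_derivative_iff_has_vector_derivative)
  then have "deriv \<psi> = D" by (auto intro!: DERIV_imp_deriv)
  with D show "(\<psi> has_real_derivative deriv \<psi> x) (at x)" "continuous_on UNIV (deriv \<psi>)" by auto
  show "continuous_on UNIV \<psi>" using D(1) by (meson DERIV_isCont continuous_at_imp_continuous_on)
  show "x \<notin> {0<..<1} \<Longrightarrow> \<psi> x = 0"
    using assms closure_subset[of "{x. \<psi> x \<noteq> 0}"] unfolding Cc1_def by blast
qed

lemma trunc_comp_deriv:
  assumes "\<And>x. (u has_real_derivative u' x) (at x)" "e > 0"
  shows "((\<lambda>x. trunc e (u x)) has_real_derivative trunc' e (u x) * u' x) (at x)"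
  using DERIV_chain'[OF assms(1) trunc_deriv[OF assms(2)]] by (simp add: mult.commute)

text \<open>Since \<open>trunc e\<close> vanishes up to \<open>e\<close>, the support lies in the
  closed set where \<open>e \<le> u x\<close>, which stays inside \<open>(0,1)\<close> because
  \<open>u\<close> is nonpositive elsewhere. The factor \<open>w\<close> is a polynomial in the
  fundamental lemma and the constant \<open>1\<close> in the density argument of
  \<open>hump_W01p\<close>.\<close>

lemma trunc_comp_Cc1:
  assumes du: "\<And>x. (u has_real_derivative u' x) (at x)" and cu': "continuous_on UNIV u'"
    and out: "\<And>x. x \<notin> {0<..<1} \<Longrightarrow> u x \<le> 0" and e: "e > 0"
    and dw: "\<And>x. (w has_real_derivative w' x) (at x)" and cw': "continuous_on UNIV w'"
  shows "(\<lambda>x. trunc e (u x) * w x) \<in> Cc1"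
proof (rule Cc1_I[where C="{x. e \<le> u x}"])
  have cu: "continuous_on UNIV u" and cw: "continuous_on UNIV w"
    using du dw by (meson DERIV_isCont continuous_at_imp_continuous_on)+
  show "((\<lambda>x. trunc e (u x) * w x) has_real_derivative
      trunc' e (u x) * u' x * w x + trunc e (u x) * w' x) (at x)" for x
    by (auto intro!: derivative_eq_intros trunc_comp_deriv[OF du e] dw)
  have "continuous_on UNIV (trunc e)"
    using trunc_deriv[OF e] by (meson DERIV_isCont continuous_at_imp_continuous_on)
  then have c1: "continuous_on UNIV (\<lambda>x. trunc e (u x))"
    by (rule continuous_on_compose2[OF _ cu]) auto
  have c2: "continuous_on UNIV (\<lambda>x. trunc' e (u x))"
    by (rule continuous_on_compose2[OF trunc'_cont[OF e] cu]) auto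
  show "continuous_on UNIV (\<lambda>x. trunc' e (u x) * u' x * w x + trunc e (u x) * w' x)"
    by (intro continuous_intros c1 c2 cu' cw cw')
  show "closed {x. e \<le> u x}" by (intro closed_Collect_le continuous_intros cu)
  show "{x. e \<le> u x} \<subseteq> {0<..<1}" using out e by force
  show "x \<notin> {x. e \<le> u x} \<Longrightarrow> trunc e (u x) * w x = 0" for x using trunc_eq_0[OF e] by auto
qed

section \<open>Integration on the unit interval and the fundamental lemma of the calculus of
  variations\<close>

lemma finite_measure_I01: "finite_measure I01"
  by (rule finite_measure_lebesgue_on) simp

lemma measure_I01: "measure I01 {0<..<1} = 1"
  by (simp add: measure_restrict_space)

lemma continuous_I01:
  fixes h :: "real \<Rightarrow> real"
  assumes "continuous_on {0..1} h"
  shows "integrable I01 h" "(LINT x|I01. h x) = integral {0..1} h"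
proof -
  have "integrable (lebesgue_on {0..1}) h"
    by (rule continuous_imp_integrable_real[OF assms])
  then have "set_integrable lebesgue {0..1} h"
    by (simp add: set_integrable_def integrable_restrict_space)
  then have "set_integrable lebesgue {0<..<1} h"
    by (rule set_integrable_subset) auto
  then show i: "integrable I01 h"
    by (simp add: set_integrable_def integrable_restrict_space)
  show "(LINT x|I01. h x) = integral {0..1} h"
    using lebesgue_integral_eq_integral[OF i] by (simp add: integral_open_interval_real)
qed

lemma measurable_I01: "continuous_on UNIV h \<Longrightarrow> (h :: real \<Rightarrow> real) \<in> borel_measurable I01"
  by (meson borel_measurable_integrable continuous_I01(1) continuous_on_subset top_greatest)

lemma AE_I01_negligible: "negligible N \<Longrightarrow> AE x in I01. x \<notin> N"
  by (subst AE_restrict_space_iff)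
     (auto simp: negligible_iff_null_sets intro: eventually_mono[OF AE_not_in])

lemma integrable_mult_continuous:
  fixes h c :: "real \<Rightarrow> real"
  assumes h: "integrable I01 h" and c: "continuous_on {0..1} c" "c \<in> borel_measurable I01"
  shows "integrable I01 (\<lambda>x. h x * c x)"
proof -
  have "compact (c ` {0..1})" using c(1) by (intro compact_continuous_image) auto
  then obtain C where C: "\<And>x. x \<in> {0..1} \<Longrightarrow> \<bar>c x\<bar> \<le> C"
    by (meson compact_imp_bounded bounded_real imageI)
  show ?thesis
  proof (rule Bochner_Integration.integrable_bound[of _ "\<lambda>x. C * h x"])
    show "integrable I01 (\<lambda>x. C * h x)" using h by simp
    show "(\<lambda>x. h x * c x) \<in> borel_measurable I01" using h c by measurable
    show "AE x in I01. norm (h x * c x) \<le> norm (C * h x)"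
    proof (rule AE_I2)
      fix x assume "x \<in> space I01"
      then have "\<bar>c x\<bar> \<le> C" using C by simp
      then have "\<bar>h x\<bar> * \<bar>c x\<bar> \<le> \<bar>h x\<bar> * \<bar>C\<bar>" by (intro mult_left_mono) auto
      then show "norm (h x * c x) \<le> norm (C * h x)" by (simp add: abs_mult mult.commute)
    qed
  qed
qed

text \<open>A polynomial is in general no test function, but the weight \<open>x * (1 - x)\<close>,
  once truncated, cuts it off near the end points. Dominated convergence removes the truncation and
  leaves the weight.\<close>

lemma fundamental_lemma_polynomial:
  assumes h: "integrable I01 h" and z: "\<And>\<psi>. \<psi> \<in> Cc1 \<Longrightarrow> (LINT x|I01. h x * \<psi> x) = 0"
    and P: "real_polynomial_function P"
  shows "(LINT x|I01. h x * (x * (1 - x)) * P x) = 0"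
proof -
  obtain P' where P': "real_polynomial_function P'" "\<And>x. (P has_real_derivative P' x) (at x)"
    using has_real_derivative_polynomial_function[OF P] by blast
  have cP: "continuous_on UNIV P" "continuous_on UNIV P'"
    using P P' by (auto intro!: continuous_on_polymonial_function simp: real_polynomial_function_eq)
  let ?e = "\<lambda>n. 1 / real (Suc n)"
  have cc: "(\<lambda>x. trunc (?e n) (x * (1 - x)) * P x) \<in> Cc1" for n
  proof (rule trunc_comp_Cc1[where u'="\<lambda>x. 1 - 2 * x" and w'=P'])
    show "((\<lambda>x. x * (1 - x)) has_real_derivative 1 - 2 * x) (at x)" for x :: real
      by (auto intro!: derivative_eq_intros)
    show "x * (1 - x) \<le> 0" if "x \<notin> {0<..<1}" for x :: real
      using that by (auto simp: mult_le_0_iff)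
  qed (auto intro!: continuous_intros P' cP)
  note m = measurable_I01[OF Cc1_D(3)[OF cc]] 
  have "compact (P ` {0..1})" using cP by (intro compact_continuous_image) (auto intro: continuous_on_subset)
  then obtain C where C: "\<And>x. x \<in> {0..1} \<Longrightarrow> \<bar>P x\<bar> \<le> C"
    by (meson compact_imp_bounded bounded_real imageI)
  have "(\<lambda>n. LINT x|I01. h x * (trunc (?e n) (x * (1 - x)) * P x))
      \<longlonglongrightarrow> (LINT x|I01. h x * (x * (1 - x) * P x))"
  proof (rule integral_dominated_convergence[where w="\<lambda>x. \<bar>h x\<bar> * (3 * C)"])
    show "integrable I01 (\<lambda>x. \<bar>h x\<bar> * (3 * C))" using h by simp
    show "(\<lambda>x. h x * (x * (1 - x) * P x)) \<in> borel_measurable I01"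
      using h by (intro borel_measurable_times[OF borel_measurable_integrable] measurable_I01 continuous_intros cP)
    show "(\<lambda>x. h x * (trunc (?e n) (x * (1 - x)) * P x)) \<in> borel_measurable I01" for n
      using h m[of n] by measurable
    show "AE x in I01. (\<lambda>n. h x * (trunc (?e n) (x * (1 - x)) * P x)) \<longlonglongrightarrow> h x * (x * (1 - x) * P x)"
      by (rule AE_I2) (auto intro!: tendsto_intros trunc_tendsto simp del: of_nat_Suc)
    show "AE x in I01. norm (h x * (trunc (?e n) (x * (1 - x)) * P x)) \<le> \<bar>h x\<bar> * (3 * C)" for n
    proof (rule AE_I2)
      fix x assume "x \<in> space I01"
      then have x: "0 < x" "x < 1" by auto
      then have s: "0 \<le> x * (1 - x)" "x * (1 - x) \<le> 1" by (auto simp: mult_le_one)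
      \<comment> \<open>The weight is at most \<open>1\<close>, and truncation with
        \<open>?e n \<le> 1\<close> changes it by at most \<open>2\<close>, whence the bound
        \<open>3\<close>.\<close>
      have "?e n \<le> 1" "?e n > 0" by auto
      then have "\<bar>trunc (?e n) (x * (1 - x))\<bar> \<le> 3"
        using trunc_approx[of "?e n" "x * (1 - x)"] s by linarith
      then have "\<bar>trunc (?e n) (x * (1 - x))\<bar> * \<bar>P x\<bar> \<le> 3 * C"
        by (intro mult_mono C) (use x in auto)
      then show "norm (h x * (trunc (?e n) (x * (1 - x)) * P x)) \<le> \<bar>h x\<bar> * (3 * C)"
        by (auto simp: abs_mult intro!: mult_left_mono)
    qed
  qed
  then have "(LINT x|I01. h x * (x * (1 - x) * P x)) = 0"
    using z[OF cc] LIMSEQ_unique[OF _ tendsto_const] by simp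
  then show ?thesis by (simp add: mult.assoc)
qed

text \<open>Stone-Weierstrass extends orthogonality from polynomials to continuous functions. These
  approximate \<open>sgn (k x)\<close> almost everywhere, and orthogonality to the sign of
  \<open>k\<close> means that \<open>\<bar>k x\<bar>\<close> has integral zero.\<close>

lemma AE_zero_if_orthogonal_to_polynomials:
  assumes k: "integrable I01 k"
    and z: "\<And>P. real_polynomial_function P \<Longrightarrow> (LINT x|I01. k x * P x) = 0"
  shows "AE x in I01. k x = 0"
proof -
  have c0: "(LINT x|I01. k x * c x) = 0" if c: "continuous_on UNIV c" for c :: "real \<Rightarrow> real"
  proof -
    have "\<bar>LINT x|I01. k x * c x\<bar> \<le> 0 + e" if "e > 0" for e
    proof -
      \<comment> \<open>The added \<open>1\<close> keeps the denominator positive when the integral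
        of \<open>\<bar>k x\<bar>\<close> vanishes.\<close>
      define d where "d = e / ((LINT x|I01. \<bar>k x\<bar>) + 1)"
      have K: "(LINT x|I01. \<bar>k x\<bar>) \<ge> 0" by simp
      then have d: "d > 0" using that by (simp only: d_def) (intro divide_pos_pos; linarith)
      obtain P where P: "real_polynomial_function P" "\<And>x. x \<in> {0..1} \<Longrightarrow> \<bar>c x - P x\<bar> < d"
        using Stone_Weierstrass_real_polynomial_function[of "{0..1}" c d] c d continuous_on_subset by blast
      have cP: "continuous_on UNIV P"
        using P(1) by (auto intro!: continuous_on_polymonial_function simp: real_polynomial_function_eq)
      have iP: "integrable I01 (\<lambda>x. k x * P x)" and ic: "integrable I01 (\<lambda>x. k x * c x)"
        using cP c by (auto intro!: integrable_mult_continuous k measurable_I01 intro: continuous_on_subset)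
      have "(LINT x|I01. k x * c x) = (LINT x|I01. k x * c x - k x * P x)"
        using iP ic z[OF P(1)] by simp
      also have "\<bar>\<dots>\<bar> \<le> (LINT x|I01. \<bar>k x * c x - k x * P x\<bar>)" by (rule integral_abs_bound)
      also have "\<dots> \<le> (LINT x|I01. d * \<bar>k x\<bar>)"
      proof (rule integral_mono)
        fix x assume "x \<in> space I01"
        then have "\<bar>c x - P x\<bar> \<le> d" using P(2)[of x] by simp
        then have "\<bar>k x\<bar> * \<bar>c x - P x\<bar> \<le> \<bar>k x\<bar> * d" by (intro mult_left_mono) auto
        then show "\<bar>k x * c x - k x * P x\<bar> \<le> d * \<bar>k x\<bar>"
          by (simp add: abs_mult[symmetric] right_diff_distrib mult.commute[of d])
      qed (use k iP ic in auto)
      also have "\<dots> = d * (LINT x|I01. \<bar>k x\<bar>)" by simp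
      also have "\<dots> \<le> d * ((LINT x|I01. \<bar>k x\<bar>) + 1)" using d by (intro mult_left_mono) auto
      also have "\<dots> = e" unfolding d_def using K by (intro nonzero_eq_divide_eq[THEN iffD1] refl) linarith
      finally show ?thesis by simp
    qed
    then have "\<bar>LINT x|I01. k x * c x\<bar> \<le> 0" by (rule field_le_epsilon)
    then show ?thesis by simp
  qed
  have "(\<lambda>x. sgn (k x)) \<in> borel_measurable I01"
    using k by (auto simp: sgn_if[abs_def] intro!: measurable_If)
  then have "(\<lambda>x. if x \<in> {0<..<1} then sgn (k x) else 0) \<in> borel_measurable lebesgue"
    by (subst borel_measurable_if) auto
  then have "(\<lambda>x. if x \<in> {0<..<1} then sgn (k x) else 0) measurable_on UNIV"
    by (intro lebesgue_measurable_imp_measurable_on_real) auto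
  then obtain N g where N: "negligible N" and g: "\<And>n. continuous_on UNIV (g n)"
    and lim: "\<And>x. x \<notin> N \<Longrightarrow> (\<lambda>n. g n x) \<longlonglongrightarrow> (if x \<in> {0<..<1} then sgn (k x) else 0)"
    unfolding measurable_on_def by auto
  \<comment> \<open>Clamping to \<open>[-1, 1]\<close> leaves the limit \<open>sgn (k x)\<close>
    unchanged and makes \<open>\<bar>k x\<bar>\<close> a dominating function.\<close>
  define c where "c n x = max (-1) (min 1 (g n x))" for n :: nat and x :: real
  have cc: "continuous_on UNIV (c n)" for n
    unfolding c_def[abs_def] by (intro continuous_intros g)
  have "(\<lambda>n. LINT x|I01. k x * c n x) \<longlonglongrightarrow> (LINT x|I01. \<bar>k x\<bar>)"
  proof (rule integral_dominated_convergence[where w="\<lambda>x. \<bar>k x\<bar>"])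
    show "(\<lambda>x. k x * c n x) \<in> borel_measurable I01" for n
      using measurable_I01[OF cc] k by measurable
    show "AE x in I01. norm (k x * c n x) \<le> \<bar>k x\<bar>" for n
      by (rule AE_I2) (auto simp: abs_mult c_def intro!: mult_left_le)
    show "AE x in I01. (\<lambda>n. k x * c n x) \<longlonglongrightarrow> \<bar>k x\<bar>"
      using AE_I01_negligible[OF N] AE_space
    proof eventually_elim
      case (elim x)
      then have "(\<lambda>n. k x * c n x) \<longlonglongrightarrow> k x * max (-1) (min 1 (sgn (k x)))"
        unfolding c_def using lim[of x] by (intro tendsto_intros) auto
      also have "k x * max (-1) (min 1 (sgn (k x))) = \<bar>k x\<bar>"
        by (auto simp: sgn_if)
      finally show ?case .
    qed
  qed (use k in auto)
  then have "(LINT x|I01. \<bar>k x\<bar>) = 0"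
    using c0[OF cc] LIMSEQ_unique[OF _ tendsto_const] by simp
  then have "AE x in I01. \<bar>k x\<bar> = 0"
    using integral_nonneg_eq_0_iff_AE[of I01 "\<lambda>x. \<bar>k x\<bar>"] k by simp
  then show ?thesis by simp
qed

text \<open>The weight \<open>x * (1 - x)\<close> left over in the polynomial version is positive on
  \<open>(0,1)\<close> and can be divided out at the end.\<close>

lemma fundamental_lemma:
  assumes h: "integrable I01 h" and z: "\<And>\<psi>. \<psi> \<in> Cc1 \<Longrightarrow> (LINT x|I01. h x * \<psi> x) = 0"
  shows "AE x in I01. h x = 0"
proof -
  have "integrable I01 (\<lambda>x. h x * (x * (1 - x)))"
    by (intro integrable_mult_continuous h measurable_I01 continuous_intros)
  then have "AE x in I01. h x * (x * (1 - x)) = 0"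
    by (rule AE_zero_if_orthogonal_to_polynomials) (rule fundamental_lemma_polynomial[OF assms])
  then show ?thesis
    using AE_space by eventually_elim auto
qed

section \<open>Weak derivatives: uniqueness and the classical case\<close>

lemma integrable_mult_Cc1:
  assumes "integrable I01 h" "\<psi> \<in> Cc1"
  shows "integrable I01 (\<lambda>x. h x * \<psi> x)" "integrable I01 (\<lambda>x. h x * deriv \<psi> x)"
  using Cc1_D[OF assms(2)]
  by (auto intro!: integrable_mult_continuous assms(1) measurable_I01 intro: continuous_on_subset)

lemma has_weak_deriv_unique:
  assumes "has_weak_deriv u g" "has_weak_deriv u h"
  shows "AE x in I01. g x = h x"
proof -
  have gh: "integrable I01 g" "integrable I01 h" using assms by (auto simp: has_weak_deriv_def)
  have "AE x in I01. g x - h x = 0"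
  proof (rule fundamental_lemma)
    fix \<psi> assume \<psi>: "\<psi> \<in> Cc1"
    then have "(LINT x|I01. g x * \<psi> x) = (LINT x|I01. h x * \<psi> x)"
      using assms unfolding has_weak_deriv_def by fastforce
    then show "(LINT x|I01. (g x - h x) * \<psi> x) = 0"
      using integrable_mult_Cc1(1)[OF _ \<psi>] gh by (simp add: left_diff_distrib)
  qed (use gh in simp)
  then show ?thesis by simp
qed

lemma wderiv:
  assumes "has_weak_deriv u g"
  shows "has_weak_deriv u (wderiv u)" "AE x in I01. wderiv u x = g x"
proof -
  show "has_weak_deriv u (wderiv u)" unfolding wderiv_def using assms by (rule someI[where P="has_weak_deriv u"])
  then show "AE x in I01. wderiv u x = g x" using assms by (rule has_weak_deriv_unique)
qed

lemma has_weak_deriv_diff: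
  assumes "has_weak_deriv u g" "has_weak_deriv v h"
  shows "has_weak_deriv (\<lambda>x. u x - v x) (\<lambda>x. g x - h x)"
  using assms integrable_mult_Cc1 unfolding has_weak_deriv_def
  by (simp add: left_diff_distrib)

text \<open>Classical integration by parts; the boundary terms vanish because test functions are
  zero at \<open>0\<close> and \<open>1\<close>, while \<open>u\<close> may have any boundary
  values.\<close>

lemma has_weak_deriv_C1:
  assumes d: "\<And>x. (u has_real_derivative u' x) (at x)" and c: "continuous_on UNIV u'"
  shows "has_weak_deriv u u'"
  unfolding has_weak_deriv_def
proof (intro conjI ballI)
  have cu: "continuous_on UNIV u" using d by (meson DERIV_isCont continuous_at_imp_continuous_on)
  have sub: "continuous_on {0..1} h" if "continuous_on UNIV h" for h :: "real \<Rightarrow> real"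
    using that continuous_on_subset by blast
  show "integrable I01 u" "integrable I01 u'" by (intro continuous_I01 sub cu c)+
  fix \<psi> assume \<psi>: "\<psi> \<in> Cc1"
  note D = Cc1_D[OF \<psi>]
  have c1: "continuous_on {0..1} (\<lambda>x. u x * deriv \<psi> x)" "continuous_on {0..1} (\<lambda>x. u' x * \<psi> x)"
    by (intro sub continuous_intros cu c D)+
  have "((\<lambda>x. u' x * \<psi> x + u x * deriv \<psi> x) has_integral (u 1 * \<psi> 1 - u 0 * \<psi> 0)) {0..1}"
  proof (rule fundamental_theorem_of_calculus)
    fix x :: real
    have "((\<lambda>x. u x * \<psi> x) has_real_derivative u' x * \<psi> x + u x * deriv \<psi> x) (at x)"
      by (auto intro!: derivative_eq_intros d D(1))
    then show "((\<lambda>x. u x * \<psi> x) has_vector_derivative u' x * \<psi> x + u x * deriv \<psi> x) (at x within {0..1})"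
      by (simp add: has_real_derivative_iff_has_vector_derivative has_vector_derivative_at_within)
  qed simp
  then have "integral {0..1} (\<lambda>x. u' x * \<psi> x + u x * deriv \<psi> x) = 0"
    using D(4)[of 0] D(4)[of 1] by (simp add: integral_unique)
  then have "integral {0..1} (\<lambda>x. u' x * \<psi> x) + integral {0..1} (\<lambda>x. u x * deriv \<psi> x) = 0"
    by (subst (asm) integral_add) (auto intro!: integrable_continuous_real c1)
  then show "(LINT x|I01. u x * deriv \<psi> x) = - (LINT x|I01. u' x * \<psi> x)"
    by (simp add: continuous_I01(2) c1)
qed

lemma has_weak_deriv_Cc1: "\<psi> \<in> Cc1 \<Longrightarrow> has_weak_deriv \<psi> (deriv \<psi>)"
  by (rule has_weak_deriv_C1) (auto intro: Cc1_D)

section \<open>Inequalities for p-th powers and the spaces \<open>Lp\<close>\<close>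

lemma powr_tangent:
  fixes a m p :: real
  assumes "p > 1" "a \<ge> 0" "m > 0"
  shows "p * m powr (p - 1) * a - (p - 1) * m powr p \<le> a powr p"
proof (cases "a = 0")
  case False
  \<comment> \<open>Young's inequality for \<open>a powr p\<close> and \<open>m powr p\<close>, with
    weights \<open>1 / p\<close> and \<open>1 - 1 / p\<close>, is the tangent inequality of the p-th
    power at \<open>m\<close>.\<close>
  then have "(a powr p) powr (1 / p) * (m powr p) powr (1 - 1 / p)
      \<le> 1 / p * a powr p + (1 - 1 / p) * m powr p"
    using assms by (intro Youngs_inequality_0) auto
  also have "(a powr p) powr (1 / p) * (m powr p) powr (1 - 1 / p) = a * m powr (p - 1)"
    using assms by (simp add: powr_powr right_diff_distrib)
  finally have "p * (a * m powr (p - 1)) \<le> p * (1 / p * a powr p + (1 - 1 / p) * m powr p)"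
    using assms by (intro mult_left_mono) auto
  also have "\<dots> = a powr p + (p - 1) * m powr p" using assms by (simp add: field_simps)
  finally show ?thesis by (simp add: algebra_simps)
qed (use assms in simp)

text \<open>Jensen's inequality, obtained by integrating the tangent inequality at \<open>m\<close>,
  the integral of \<open>\<bar>w x\<bar>\<close>. A total mass below \<open>1\<close> only shrinks
  the subtracted constant, so the half interval is covered as well as \<open>(0,1)\<close>.\<close>

lemma integral_powr_le:
  fixes w :: "'a \<Rightarrow> real"
  assumes M: "finite_measure M" "measure M (space M) \<le> 1" and p: "p > 1"
    and w: "integrable M w" "integrable M (\<lambda>x. \<bar>w x\<bar> powr p)"
  shows "(LINT x|M. \<bar>w x\<bar>) powr p \<le> (LINT x|M. \<bar>w x\<bar> powr p)"
proof -
  interpret finite_measure M by fact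
  define m where "m = (LINT x|M. \<bar>w x\<bar>)"
  have "m \<ge> 0" by (simp add: m_def)
  show ?thesis
  proof (cases "m = 0")
    case False
    with \<open>m \<ge> 0\<close> have m: "m > 0" by simp
    have "m powr p = p * m powr (p - 1) * m - (p - 1) * m powr p * 1"
      using m by (simp add: powr_diff field_simps)
    also have "\<dots> \<le> p * m powr (p - 1) * m - (p - 1) * m powr p * measure M (space M)"
      using p M(2) by (intro diff_mono mult_left_mono order_refl) auto
    also have "\<dots> = (LINT x|M. p * m powr (p - 1) * \<bar>w x\<bar> - (p - 1) * m powr p)"
      using w by (simp add: m_def mult.commute)
    also have "\<dots> \<le> (LINT x|M. \<bar>w x\<bar> powr p)"
      using w p m by (intro integral_mono powr_tangent) auto
    finally show ?thesis by (simp add: m_def)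
  qed (simp add: m_def)
qed

text \<open>Both summands are bounded by the larger one. This crude triangle inequality stands in
  for Minkowski's where only the finiteness of a constant matters.\<close>

lemma powr_add_le:
  fixes a b p :: real
  assumes "p > 0"
  shows "\<bar>a + b\<bar> powr p \<le> 2 powr p * (\<bar>a\<bar> powr p + \<bar>b\<bar> powr p)"
proof -
  have "\<bar>a + b\<bar> powr p \<le> (2 * max \<bar>a\<bar> \<bar>b\<bar>) powr p"
    using assms by (intro powr_mono2) auto
  also have "\<dots> = 2 powr p * max \<bar>a\<bar> \<bar>b\<bar> powr p" by (simp add: powr_mult)
  also have "\<dots> \<le> 2 powr p * (\<bar>a\<bar> powr p + \<bar>b\<bar> powr p)"
    by (intro mult_left_mono) (auto simp: max_def)
  finally show ?thesis .
qed

lemma Lp_D: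
  assumes "w \<in> Lp p"
  shows "w \<in> borel_measurable I01" "integrable I01 (\<lambda>x. \<bar>w x\<bar> powr p)"
  using assms by (auto simp: Lp_def)

lemma Lp_integrable:
  assumes "w \<in> Lp p" "p > 1"
  shows "integrable I01 w"
proof (rule Bochner_Integration.integrable_bound)
  interpret finite_measure I01 by (rule finite_measure_I01)
  show "integrable I01 (\<lambda>x. 1 + \<bar>w x\<bar> powr p)" using Lp_D[OF assms(1)] by simp
  show "AE x in I01. norm (w x) \<le> norm (1 + \<bar>w x\<bar> powr p)"
  proof (rule AE_I2)
    fix x
    have "\<bar>w x\<bar> \<le> 1 + \<bar>w x\<bar> powr p"
    proof (cases "\<bar>w x\<bar> \<le> 1")
      case False
      then have "\<bar>w x\<bar> powr 1 \<le> \<bar>w x\<bar> powr p" using assms(2) by (intro powr_mono) auto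
      then show ?thesis using False by simp
    qed (simp add: add_increasing2)
    then show "norm (w x) \<le> norm (1 + \<bar>w x\<bar> powr p)" by simp
  qed
qed (use Lp_D[OF assms(1)] in auto)

lemma Lp_integral_powr_le:
  assumes "w \<in> Lp p" "p > 1"
  shows "(LINT x|I01. \<bar>w x\<bar>) powr p \<le> (LINT x|I01. \<bar>w x\<bar> powr p)"
  by (rule integral_powr_le)
     (use assms in \<open>auto simp: finite_measure_I01 measure_I01 Lp_integrable Lp_D\<close>)

lemma Lp_integral_le_norm:
  assumes "w \<in> Lp p" "p > 1"
  shows "(LINT x|I01. \<bar>w x\<bar>) \<le> Lp_norm p w"
proof -
  have "((LINT x|I01. \<bar>w x\<bar>) powr p) powr (1 / p) \<le> Lp_norm p w"
    unfolding Lp_norm_def using assms by (intro powr_mono2 Lp_integral_powr_le) auto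
  then show ?thesis using assms(2) by (simp add: powr_powr)
qed

lemma Lp_norm_powr:
  assumes "p > 1"
  shows "Lp_norm p w powr p = (LINT x|I01. \<bar>w x\<bar> powr p)"
  using assms by (simp add: Lp_norm_def powr_powr)

lemma Lp_norm_nonneg [simp]: "Lp_norm p w \<ge> 0"
  by (simp add: Lp_norm_def)

lemma Lp_norm_cong_AE:
  assumes "w \<in> borel_measurable I01" "v \<in> borel_measurable I01" "AE x in I01. w x = v x"
  shows "Lp_norm p w = Lp_norm p v"
  unfolding Lp_norm_def
  by (intro arg_cong2[where f="(powr)"] integral_cong_AE refl) (use assms in auto)

lemma Lp_cong_AE:
  assumes "w \<in> Lp p" "v \<in> borel_measurable I01" "AE x in I01. w x = v x"
  shows "v \<in> Lp p"
proof -
  have "integrable I01 (\<lambda>x. \<bar>v x\<bar> powr p)"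
    by (rule integrable_cong_AE_imp[OF Lp_D(2)[OF assms(1)]]) (use assms in auto)
  then show ?thesis using assms by (simp add: Lp_def)
qed

lemma Lp_diff:
  assumes "w \<in> Lp p" "v \<in> Lp p" "p > 1"
  shows "(\<lambda>x. w x - v x) \<in> Lp p"
proof -
  note D = Lp_D[OF assms(1)] Lp_D[OF assms(2)]
  have "integrable I01 (\<lambda>x. \<bar>w x - v x\<bar> powr p)"
  proof (rule Bochner_Integration.integrable_bound)
    show "integrable I01 (\<lambda>x. 2 powr p * (\<bar>w x\<bar> powr p + \<bar>v x\<bar> powr p))" using D by simp
    show "(\<lambda>x. \<bar>w x - v x\<bar> powr p) \<in> borel_measurable I01" using D by measurable
    show "AE x in I01. norm (\<bar>w x - v x\<bar> powr p) \<le> norm (2 powr p * (\<bar>w x\<bar> powr p + \<bar>v x\<bar> powr p))"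
      using powr_add_le[of p "w _" "- v _"] assms(3) by (intro AE_I2) simp
  qed
  then show ?thesis using D by (simp add: Lp_def)
qed

lemma continuous_on_abs_powr:
  fixes h :: "real \<Rightarrow> real"
  assumes "continuous_on S h" "p > 0"
  shows "continuous_on S (\<lambda>x. \<bar>h x\<bar> powr p)"
  by (rule continuous_on_powr') (use assms in \<open>auto intro!: continuous_intros\<close>)

lemma Lp_continuous:
  assumes "continuous_on UNIV h" "p > 0"
  shows "h \<in> Lp p"
  unfolding Lp_def using assms
  by (auto intro!: measurable_I01 continuous_I01 continuous_on_abs_powr intro: continuous_on_subset)

lemma Lp_norm_le_imp:
  assumes "p > 1" "C \<ge> 0" "(LINT x|I01. \<bar>w x\<bar> powr p) \<le> C powr p * (LINT x|I01. \<bar>v x\<bar> powr p)"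
  shows "Lp_norm p w \<le> C * Lp_norm p v"
proof -
  have "Lp_norm p w \<le> (C powr p * (LINT x|I01. \<bar>v x\<bar> powr p)) powr (1 / p)"
    unfolding Lp_norm_def using assms by (intro powr_mono2) auto
  also have "\<dots> = C * Lp_norm p v"
    using assms by (simp add: Lp_norm_def powr_mult powr_powr)
  finally show ?thesis .
qed

section \<open>Approximation, integration by parts and the Poincare inequality in
  \<open>W01p\<close>\<close>

lemma W01p_D:
  assumes "u \<in> W01p p"
  shows "u \<in> Lp p" "has_weak_deriv u (wderiv u)" "wderiv u \<in> Lp p" "continuous_on {0..1} u"
proof -
  obtain g where g: "u \<in> Lp p" "g \<in> Lp p" "has_weak_deriv u g" "continuous_on {0..1} u"
    using assms by (auto simp: W01p_def W1p_def)
  then show "u \<in> Lp p" "continuous_on {0..1} u" by auto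
  show w: "has_weak_deriv u (wderiv u)" using wderiv[OF g(3)] by simp
  have "AE x in I01. g x = wderiv u x" using wderiv(2)[OF g(3)] by eventually_elim simp
  then show "wderiv u \<in> Lp p"
    using w by (intro Lp_cong_AE[OF g(2)]) (auto simp: has_weak_deriv_def)
qed

lemma Cc1_Lp:
  assumes "\<psi> \<in> Cc1" "p > 0"
  shows "\<psi> \<in> Lp p" "deriv \<psi> \<in> Lp p"
  using Lp_continuous Cc1_D(2,3)[OF assms(1)] assms(2) by auto

lemma powr_tendsto_0:
  fixes X :: "nat \<Rightarrow> real"
  assumes "X \<longlonglongrightarrow> 0" "\<And>n. X n \<ge> 0" "p > 0"
  shows "(\<lambda>n. X n powr p) \<longlonglongrightarrow> 0"
proof -
  have "(\<lambda>n. X n powr p) \<longlonglongrightarrow> 0 powr p"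
    by (rule tendsto_powr') (use assms in auto)
  then show ?thesis using assms by simp
qed

text \<open>The definition of \<open>W01p\<close> measures the chosen weak derivative of the
  difference; here it is exchanged for the difference with the classical derivative of the test
  function. Powers instead of norms fit the crude triangle inequality.\<close>

lemma W01p_approx:
  assumes u: "u \<in> W01p p" and p: "p > 1"
  obtains \<psi> where "\<And>n::nat. \<psi> n \<in> Cc1"
    "(\<lambda>n. LINT x|I01. \<bar>u x - \<psi> n x\<bar> powr p) \<longlonglongrightarrow> 0"
    "(\<lambda>n. LINT x|I01. \<bar>wderiv u x - deriv (\<psi> n) x\<bar> powr p) \<longlonglongrightarrow> 0"
proof -
  obtain \<psi> where \<psi>: "\<And>n::nat. \<psi> n \<in> Cc1"
    and lim: "(\<lambda>n. W1p_norm p (\<lambda>x. u x - \<psi> n x)) \<longlonglongrightarrow> 0"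
    using u by (auto simp: W01p_def)
  have l1: "(\<lambda>n. Lp_norm p (\<lambda>x. u x - \<psi> n x)) \<longlonglongrightarrow> 0"
    by (rule tendsto_sandwich[OF _ _ tendsto_const lim]) (auto simp: W1p_norm_def)
  have l2: "(\<lambda>n. Lp_norm p (wderiv (\<lambda>x. u x - \<psi> n x))) \<longlonglongrightarrow> 0"
    by (rule tendsto_sandwich[OF _ _ tendsto_const lim]) (auto simp: W1p_norm_def)
  have eq: "Lp_norm p (wderiv (\<lambda>x. u x - \<psi> n x)) = Lp_norm p (\<lambda>x. wderiv u x - deriv (\<psi> n) x)" for n
  proof (rule Lp_norm_cong_AE)
    have h: "has_weak_deriv (\<lambda>x. u x - \<psi> n x) (\<lambda>x. wderiv u x - deriv (\<psi> n) x)"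
      by (rule has_weak_deriv_diff[OF W01p_D(2)[OF u] has_weak_deriv_Cc1[OF \<psi>]])
    show "AE x in I01. wderiv (\<lambda>x. u x - \<psi> n x) x = wderiv u x - deriv (\<psi> n) x"
      by (rule wderiv(2)[OF h])
    show "wderiv (\<lambda>x. u x - \<psi> n x) \<in> borel_measurable I01"
      "(\<lambda>x. wderiv u x - deriv (\<psi> n) x) \<in> borel_measurable I01"
      using h wderiv(1)[OF h] by (auto simp: has_weak_deriv_def)
  qed
  show thesis
  proof (rule that[OF \<psi>])
    show "(\<lambda>n. LINT x|I01. \<bar>u x - \<psi> n x\<bar> powr p) \<longlonglongrightarrow> 0"
      using powr_tendsto_0[OF l1, of p] p by (simp add: Lp_norm_powr)
    show "(\<lambda>n. LINT x|I01. \<bar>wderiv u x - deriv (\<psi> n) x\<bar> powr p) \<longlonglongrightarrow> 0"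
      using powr_tendsto_0[OF l2[unfolded eq], of p] p by (simp add: Lp_norm_powr)
  qed
qed

lemma Lp_tendsto_L1:
  assumes "\<And>n. w n \<in> Lp p" "p > 1" "(\<lambda>n. LINT x|I01. \<bar>w n x\<bar> powr p) \<longlonglongrightarrow> 0"
  shows "(\<lambda>n. LINT x|I01. \<bar>w n x\<bar>) \<longlonglongrightarrow> 0"
proof -
  have l: "(\<lambda>n. (LINT x|I01. \<bar>w n x\<bar> powr p) powr (1 / p)) \<longlonglongrightarrow> 0"
    using assms by (intro powr_tendsto_0) auto
  show ?thesis
    by (rule tendsto_sandwich[OF _ _ tendsto_const l])
       (use Lp_integral_le_norm[OF assms(1,2)] in \<open>auto simp: Lp_norm_def\<close>)
qed

lemma tendsto_LINT_mult_bounded: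
  fixes Z v :: "real \<Rightarrow> real" and w :: "nat \<Rightarrow> real \<Rightarrow> real"
  assumes w: "\<And>n. integrable I01 (w n)" "integrable I01 v"
    and lim: "(\<lambda>n. LINT x|I01. \<bar>v x - w n x\<bar>) \<longlonglongrightarrow> 0"
    and Z: "continuous_on UNIV Z"
  shows "(\<lambda>n. LINT x|I01. Z x * w n x) \<longlonglongrightarrow> (LINT x|I01. Z x * v x)"
proof -
  have cZ: "continuous_on {0..1} Z" using Z continuous_on_subset by blast
  then have "compact (Z ` {0..1})" by (intro compact_continuous_image) auto
  then obtain C where C: "\<And>x. x \<in> {0..1} \<Longrightarrow> \<bar>Z x\<bar> \<le> C"
    by (meson compact_imp_bounded bounded_real imageI)
  have i: "integrable I01 (\<lambda>x. Z x * w n x)" "integrable I01 (\<lambda>x. Z x * v x)" for n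
    using w by (subst mult.commute, intro integrable_mult_continuous cZ measurable_I01[OF Z], simp)+
  have "(\<lambda>n. (LINT x|I01. Z x * w n x) - (LINT x|I01. Z x * v x)) \<longlonglongrightarrow> 0"
  proof (rule Lim_null_comparison)
    show "\<forall>\<^sub>F n in sequentially. norm ((LINT x|I01. Z x * w n x) - (LINT x|I01. Z x * v x))
        \<le> C * (LINT x|I01. \<bar>v x - w n x\<bar>)"
    proof (rule always_eventually, rule allI)
      fix n
      have "norm ((LINT x|I01. Z x * w n x) - (LINT x|I01. Z x * v x))
          = \<bar>LINT x|I01. Z x * w n x - Z x * v x\<bar>"
        using i by simp
      also have "\<dots> \<le> (LINT x|I01. \<bar>Z x * w n x - Z x * v x\<bar>)" by (rule integral_abs_bound)
      also have "\<dots> \<le> (LINT x|I01. C * \<bar>v x - w n x\<bar>)"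
      proof (rule integral_mono)
        fix x assume "x \<in> space I01"
        then have "\<bar>Z x\<bar> * \<bar>w n x - v x\<bar> \<le> C * \<bar>w n x - v x\<bar>"
          using C[of x] by (intro mult_right_mono) auto
        then show "\<bar>Z x * w n x - Z x * v x\<bar> \<le> C * \<bar>v x - w n x\<bar>"
          by (simp add: abs_mult[symmetric] right_diff_distrib abs_minus_commute)
      qed (use w i in auto)
      finally show "norm ((LINT x|I01. Z x * w n x) - (LINT x|I01. Z x * v x))
          \<le> C * (LINT x|I01. \<bar>v x - w n x\<bar>)" by simp
    qed
    show "(\<lambda>n. C * (LINT x|I01. \<bar>v x - w n x\<bar>)) \<longlonglongrightarrow> 0"
      by (rule tendsto_mult_right_zero[OF lim])
  qed
  then show ?thesis by (simp add: LIM_zero_iff)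
qed

text \<open>The roles in the definition of a weak derivative are exchanged: \<open>Z\<close> is the
  function being differentiated, and the approximants of \<open>w\<close> serve as test functions.
  Both sides converge because \<open>Z\<close> and \<open>Z'\<close> are bounded on
  \<open>[0,1]\<close>.\<close>

lemma W01p_integration_by_parts:
  assumes w: "w \<in> W01p p" and p: "p > 1"
    and dZ: "\<And>x. (Z has_real_derivative Z' x) (at x)" and cZ': "continuous_on UNIV Z'"
  shows "(LINT x|I01. Z x * wderiv w x) = - (LINT x|I01. Z' x * w x)"
proof -
  obtain \<psi> where \<psi>: "\<And>n::nat. \<psi> n \<in> Cc1"
    and l1: "(\<lambda>n. LINT x|I01. \<bar>w x - \<psi> n x\<bar> powr p) \<longlonglongrightarrow> 0"
    and l2: "(\<lambda>n. LINT x|I01. \<bar>wderiv w x - deriv (\<psi> n) x\<bar> powr p) \<longlonglongrightarrow> 0"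
    using W01p_approx[OF w p] by blast
  have L: "\<psi> n \<in> Lp p" "deriv (\<psi> n) \<in> Lp p" for n using Cc1_Lp[OF \<psi>] p by auto
  note W = W01p_D[OF w]
  have cZ: "continuous_on UNIV Z" using dZ by (meson DERIV_isCont continuous_at_imp_continuous_on)
  have "(\<lambda>n. LINT x|I01. Z x * deriv (\<psi> n) x) \<longlonglongrightarrow> (LINT x|I01. Z x * wderiv w x)"
    by (intro tendsto_LINT_mult_bounded Lp_integrable[OF _ p] L W cZ Lp_tendsto_L1[OF _ p l2] Lp_diff[OF _ _ p])
  moreover have "(\<lambda>n. - (LINT x|I01. Z' x * \<psi> n x)) \<longlonglongrightarrow> - (LINT x|I01. Z' x * w x)"
    by (intro tendsto_minus tendsto_LINT_mult_bounded Lp_integrable[OF _ p] L W cZ'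
        Lp_tendsto_L1[OF _ p l1] Lp_diff[OF _ _ p])
  moreover have "(LINT x|I01. Z x * deriv (\<psi> n) x) = - (LINT x|I01. Z' x * \<psi> n x)" for n
    using has_weak_deriv_C1[OF dZ cZ'] \<psi> unfolding has_weak_deriv_def by blast
  ultimately show ?thesis using LIMSEQ_unique by simp
qed

text \<open>Since \<open>\<psi>\<close> vanishes at \<open>0\<close>, its values are at most the
  integral of \<open>\<bar>deriv \<psi> x\<bar>\<close>, to which Jensen's inequality applies; the
  pointwise bound is then integrated over an interval of length \<open>1\<close>.\<close>

lemma Cc1_poincare:
  assumes \<psi>: "\<psi> \<in> Cc1" and p: "p > 1"
  shows "(LINT x|I01. \<bar>\<psi> x\<bar> powr p) \<le> (LINT x|I01. \<bar>deriv \<psi> x\<bar> powr p)"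
proof -
  note D = Cc1_D[OF \<psi>]
  have ca: "continuous_on S (\<lambda>x. \<bar>deriv \<psi> x\<bar>)" for S
    using D(2) by (intro continuous_on_rabs) (auto intro: continuous_on_subset)
  have L: "\<psi> \<in> Lp p" "deriv \<psi> \<in> Lp p" using Cc1_Lp[OF \<psi>] p by auto
  have b: "\<bar>\<psi> x\<bar> powr p \<le> (LINT x|I01. \<bar>deriv \<psi> x\<bar> powr p)" if x: "x \<in> {0<..<1}" for x
  proof -
    have "(deriv \<psi> has_integral (\<psi> x - \<psi> 0)) {0..x}"
      using x D(1) by (intro fundamental_theorem_of_calculus)
        (auto simp: has_real_derivative_iff_has_vector_derivative intro: has_vector_derivative_at_within)
    then have "\<bar>\<psi> x\<bar> = \<bar>integral {0..x} (deriv \<psi>)\<bar>" using D(4)[of 0] by (simp add: integral_unique)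
    also have "\<dots> \<le> integral {0..x} (\<lambda>x. \<bar>deriv \<psi> x\<bar>)"
      unfolding real_norm_def[symmetric] using D(2) ca
      by (intro Henstock_Kurzweil_Integration.integral_norm_bound_integral integrable_continuous_real)
         (auto intro: continuous_on_subset)
    also have "\<dots> \<le> integral {0..1} (\<lambda>x. \<bar>deriv \<psi> x\<bar>)"
      using x by (intro integral_subset_le integrable_continuous_real ca) auto
    also have "\<dots> = (LINT x|I01. \<bar>deriv \<psi> x\<bar>)" using continuous_I01(2)[OF ca] by simp
    finally have "\<bar>\<psi> x\<bar> powr p \<le> (LINT x|I01. \<bar>deriv \<psi> x\<bar>) powr p" using p by (intro powr_mono2) auto
    also have "\<dots> \<le> (LINT x|I01. \<bar>deriv \<psi> x\<bar> powr p)" by (rule Lp_integral_powr_le[OF L(2) p])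
    finally show ?thesis .
  qed
  interpret finite_measure I01 by (rule finite_measure_I01)
  have "(LINT x|I01. \<bar>\<psi> x\<bar> powr p) \<le> (LINT x|I01. (LINT x|I01. \<bar>deriv \<psi> x\<bar> powr p))"
    using b by (intro integral_mono Lp_D[OF L(1)]) auto
  also have "\<dots> = (LINT x|I01. \<bar>deriv \<psi> x\<bar> powr p)" by (simp add: measure_I01)
  finally show ?thesis .
qed

lemma LINT_powr_add_le:
  assumes "w \<in> Lp p" "v \<in> Lp p" "p > 1"
  shows "(LINT x|I01. \<bar>w x\<bar> powr p)
    \<le> 2 powr p * ((LINT x|I01. \<bar>w x - v x\<bar> powr p) + (LINT x|I01. \<bar>v x\<bar> powr p))"
proof -
  note D = Lp_D[OF assms(1)] Lp_D[OF assms(2)] Lp_D[OF Lp_diff[OF assms]]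
  have "(LINT x|I01. \<bar>w x\<bar> powr p) \<le> (LINT x|I01. 2 powr p * (\<bar>w x - v x\<bar> powr p + \<bar>v x\<bar> powr p))"
    using powr_add_le[of p "w x - v x" "v x" for x] assms(3) D by (intro integral_mono) auto
  then show ?thesis using D by simp
qed

text \<open>The inequality for test functions passes to the limit. Each of two uses of the crude
  triangle inequality costs a factor \<open>2\<close> in the norm, hence the \<open>4\<close>; it
  serves to show that some constant is admissible.\<close>

lemma poincare:
  assumes u: "u \<in> W01p p" and p: "p > 1"
  shows "Lp_norm p u \<le> 4 * W01p_norm p u"
proof -
  obtain \<psi> where \<psi>: "\<And>n::nat. \<psi> n \<in> Cc1"
    and l1: "(\<lambda>n. LINT x|I01. \<bar>u x - \<psi> n x\<bar> powr p) \<longlonglongrightarrow> 0"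
    and l2: "(\<lambda>n. LINT x|I01. \<bar>wderiv u x - deriv (\<psi> n) x\<bar> powr p) \<longlonglongrightarrow> 0"
    using W01p_approx[OF u p] by blast
  have L: "\<psi> n \<in> Lp p" "deriv (\<psi> n) \<in> Lp p" for n using Cc1_Lp[OF \<psi>] p by auto
  note W = W01p_D[OF u]
  have "(LINT x|I01. \<bar>u x\<bar> powr p) \<le> 2 powr p * ((LINT x|I01. \<bar>u x - \<psi> n x\<bar> powr p)
      + 2 powr p * ((LINT x|I01. \<bar>wderiv u x - deriv (\<psi> n) x\<bar> powr p) + (LINT x|I01. \<bar>wderiv u x\<bar> powr p)))" for n
  proof -
    have "(LINT x|I01. \<bar>deriv (\<psi> n) x\<bar> powr p) \<le> 2 powr p * ((LINT x|I01. \<bar>wderiv u x - deriv (\<psi> n) x\<bar> powr p)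
      + (LINT x|I01. \<bar>wderiv u x\<bar> powr p))"
      using LINT_powr_add_le[OF L(2) W(3) p] by (simp add: abs_minus_commute)
    then show ?thesis
      using LINT_powr_add_le[OF W(1) L(1) p, of n] Cc1_poincare[OF \<psi>[of n] p]
      by (elim order_trans) (intro mult_left_mono add_left_mono; simp)
  qed
  moreover have "(\<lambda>n. 2 powr p * ((LINT x|I01. \<bar>u x - \<psi> n x\<bar> powr p)
      + 2 powr p * ((LINT x|I01. \<bar>wderiv u x - deriv (\<psi> n) x\<bar> powr p) + (LINT x|I01. \<bar>wderiv u x\<bar> powr p))))
    \<longlonglongrightarrow> 2 powr p * (0 + 2 powr p * (0 + (LINT x|I01. \<bar>wderiv u x\<bar> powr p)))"
    by (intro tendsto_intros l1 l2)
  ultimately have "(LINT x|I01. \<bar>u x\<bar> powr p) \<le> 2 powr p * (0 + 2 powr p * (0 + (LINT x|I01. \<bar>wderiv u x\<bar> powr p)))"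
    using LIMSEQ_le_const by blast
  then have "(LINT x|I01. \<bar>u x\<bar> powr p) \<le> 4 powr p * (LINT x|I01. \<bar>wderiv u x\<bar> powr p)"
    by (simp add: mult.assoc[symmetric] powr_mult[symmetric])
  then show ?thesis unfolding W01p_norm_def using p by (intro Lp_norm_le_imp) auto
qed

text \<open>A \<open>LEAST\<close> over the reals is meaningful only when it is attained. The set of
  admissible constants is nonempty by \<open>poincare\<close>, bounded below by \<open>0\<close> as
  soon as one function has positive norm, and contains its infimum.\<close>

lemma poincare_const:
  assumes p: "p > 1" and nz: "u \<in> W01p p" "W01p_norm p u > 0" and w: "w \<in> W01p p"
  shows "Lp_norm p w \<le> poincare_const p * W01p_norm p w"
proof -
  define S where "S = {c. \<forall>w\<in>W01p p. Lp_norm p w \<le> c * W01p_norm p w}"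
  have S4: "4 \<in> S" using poincare[OF _ p] by (auto simp: S_def)
  have bdd: "c \<ge> 0" if "c \<in> S" for c
  proof -
    have "0 \<le> c * W01p_norm p u" using that nz unfolding S_def
      by (metis (mono_tags, lifting) Lp_norm_nonneg mem_Collect_eq order_trans)
    then show ?thesis using nz(2) by (simp add: zero_le_mult_iff)
  qed
  have "\<forall>w\<in>W01p p. Lp_norm p w \<le> Inf S * W01p_norm p w"
  proof
    fix w assume w: "w \<in> W01p p"
    have N: "W01p_norm p w \<ge> 0" by (simp add: W01p_norm_def)
    show "Lp_norm p w \<le> Inf S * W01p_norm p w"
    proof (cases "W01p_norm p w = 0")
      case True
      \<comment> \<open>With norm zero, the admissible constant \<open>4\<close> already forces
        \<open>Lp_norm p w\<close> to be at most \<open>0\<close>.\<close>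
      then show ?thesis using S4 w by (auto simp: S_def)
    next
      case False
      then have "Lp_norm p w / W01p_norm p w \<le> c" if "c \<in> S" for c
        using that w N by (auto simp: S_def divide_le_eq)
      then have "Lp_norm p w / W01p_norm p w \<le> Inf S" using S4 by (intro cInf_greatest) auto
      then show ?thesis using False N by (simp add: divide_le_eq)
    qed
  qed
  then have InfS: "Inf S \<in> S" by (simp add: S_def)
  moreover have "Inf S \<le> c" if "c \<in> S" for c
    using that bdd by (intro cInf_lower bdd_belowI[of _ 0]) auto
  ultimately have "poincare_const p = Inf S"
    unfolding poincare_const_def S_def by (intro Least_equality) auto
  then show ?thesis using InfS w by (simp add: S_def)
qed

text \<open>Truncating \<open>u\<close> at level \<open>1 / (n + 1)\<close> gives test functions,
  since \<open>u\<close> is nonpositive outside \<open>(0,1)\<close>. Positivity inside makes their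
  derivatives converge to \<open>u'\<close> at every point, and dominated convergence turns this
  into approximation in the Sobolev norm.\<close>

lemma hump_W01p:
  assumes du: "\<And>x. (u has_real_derivative u' x) (at x)" and cu': "continuous_on UNIV u'"
    and pos: "\<And>x. x \<in> {0<..<1} \<Longrightarrow> u x > 0" and out: "\<And>x. x \<notin> {0<..<1} \<Longrightarrow> u x \<le> 0" and p: "p > 1"
  shows "u \<in> W01p p" "AE x in I01. wderiv u x = u' x"
    "W01p_norm p u = (integral {0..1} (\<lambda>x. \<bar>u' x\<bar> powr p)) powr (1 / p)"
proof -
  have cu: "continuous_on UNIV u" using du by (meson DERIV_isCont continuous_at_imp_continuous_on)
  note wd = has_weak_deriv_C1[OF du cu']
  have L: "u \<in> Lp p" "u' \<in> Lp p" using cu cu' p by (auto intro: Lp_continuous)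
  show ae: "AE x in I01. wderiv u x = u' x" by (rule wderiv(2)[OF wd])
  have mw: "wderiv u \<in> borel_measurable I01" "u' \<in> borel_measurable I01"
    using wderiv(1)[OF wd] wd by (auto simp: has_weak_deriv_def)
  have "W01p_norm p u = Lp_norm p u'" unfolding W01p_norm_def by (rule Lp_norm_cong_AE[OF mw ae])
  also have "\<dots> = (integral {0..1} (\<lambda>x. \<bar>u' x\<bar> powr p)) powr (1 / p)"
    unfolding Lp_norm_def using p cu'
    by (subst continuous_I01(2)) (auto intro!: continuous_on_abs_powr intro: continuous_on_subset)
  finally show "W01p_norm p u = (integral {0..1} (\<lambda>x. \<bar>u' x\<bar> powr p)) powr (1 / p)" .
  let ?e = "\<lambda>n. 1 / real (Suc n)"
  let ?\<psi> = "\<lambda>n x. trunc (?e n) (u x) * 1"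
  have e: "?e n > 0" "?e n \<le> 1" for n by auto
  have \<psi>: "?\<psi> n \<in> Cc1" for n
    by (rule trunc_comp_Cc1[OF du cu' out e(1) DERIV_const]) auto
  have d\<psi>: "deriv (?\<psi> n) = (\<lambda>x. trunc' (?e n) (u x) * u' x)" for n
    using trunc_comp_deriv[OF du e(1)] by (auto intro!: DERIV_imp_deriv simp del: of_nat_Suc)
  have m\<psi>: "?\<psi> n \<in> borel_measurable I01" "deriv (?\<psi> n) \<in> borel_measurable I01" for n
    using Cc1_Lp[OF \<psi>[of n], of p] p by (auto simp: Lp_def)
  interpret finite_measure I01 by (rule finite_measure_I01)
  have "(\<lambda>n. LINT x|I01. \<bar>u x - ?\<psi> n x\<bar> powr p) \<longlonglongrightarrow> (LINT x|I01. 0)"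
  proof (rule integral_dominated_convergence[where w="\<lambda>x. 2 powr p"])
    show "(\<lambda>x. \<bar>u x - ?\<psi> n x\<bar> powr p) \<in> borel_measurable I01" for n
      using m\<psi>(1)[of n] Lp_D(1)[OF L(1)] by measurable
    show "AE x in I01. (\<lambda>n. \<bar>u x - ?\<psi> n x\<bar> powr p) \<longlonglongrightarrow> 0"
    proof (rule AE_I2)
      fix x assume "x \<in> space I01"
      then have "(\<lambda>n. \<bar>u x - ?\<psi> n x\<bar>) \<longlonglongrightarrow> \<bar>u x - u x * 1\<bar>"
        using pos[of x] by (intro tendsto_intros trunc_tendsto) auto
      then show "(\<lambda>n. \<bar>u x - ?\<psi> n x\<bar> powr p) \<longlonglongrightarrow> 0"
        using p by (intro powr_tendsto_0) auto
    qed
    show "AE x in I01. norm (\<bar>u x - ?\<psi> n x\<bar> powr p) \<le> 2 powr p" for n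
    proof (rule AE_I2)
      fix x assume "x \<in> space I01"
      then have "\<bar>u x - trunc (?e n) (u x)\<bar> \<le> 2 * ?e n"
        using pos[of x] by (intro trunc_approx e) auto
      also have "\<dots> \<le> 2" using e(2)[of n] by linarith
      finally have "\<bar>u x - ?\<psi> n x\<bar> \<le> 2" by simp
      then show "norm (\<bar>u x - ?\<psi> n x\<bar> powr p) \<le> 2 powr p" using p by (simp add: powr_mono2)
    qed
  qed auto
  then have l1: "(\<lambda>n. Lp_norm p (\<lambda>x. u x - ?\<psi> n x)) \<longlonglongrightarrow> 0"
    unfolding Lp_norm_def using p by (intro powr_tendsto_0) auto
  have "(\<lambda>n. LINT x|I01. \<bar>u' x - deriv (?\<psi> n) x\<bar> powr p) \<longlonglongrightarrow> (LINT x|I01. 0)"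
  proof (rule integral_dominated_convergence[where w="\<lambda>x. \<bar>u' x\<bar> powr p"])
    show "integrable I01 (\<lambda>x. \<bar>u' x\<bar> powr p)" by (rule Lp_D[OF L(2)])
    show "(\<lambda>x. \<bar>u' x - deriv (?\<psi> n) x\<bar> powr p) \<in> borel_measurable I01" for n
      using m\<psi>(2)[of n] Lp_D(1)[OF L(2)] by measurable
    show "AE x in I01. (\<lambda>n. \<bar>u' x - deriv (?\<psi> n) x\<bar> powr p) \<longlonglongrightarrow> 0"
    proof (rule AE_I2)
      fix x assume "x \<in> space I01"
      then have "(\<lambda>n. \<bar>u' x - deriv (?\<psi> n) x\<bar>) \<longlonglongrightarrow> \<bar>u' x - 1 * u' x\<bar>"
        unfolding d\<psi> using pos[of x] by (intro tendsto_intros trunc'_tendsto) auto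
      then show "(\<lambda>n. \<bar>u' x - deriv (?\<psi> n) x\<bar> powr p) \<longlonglongrightarrow> 0"
        using p by (intro powr_tendsto_0) auto
    qed
    show "AE x in I01. norm (\<bar>u' x - deriv (?\<psi> n) x\<bar> powr p) \<le> \<bar>u' x\<bar> powr p" for n
    proof (rule AE_I2)
      fix x
      have "\<bar>1 - trunc' (?e n) (u x)\<bar> \<le> 1" using trunc'_bounds[OF e(1)[of n], of "u x"] by simp
      then have "\<bar>1 - trunc' (?e n) (u x)\<bar> * \<bar>u' x\<bar> \<le> 1 * \<bar>u' x\<bar>" by (intro mult_right_mono) auto
      then have "\<bar>u' x - deriv (?\<psi> n) x\<bar> \<le> \<bar>u' x\<bar>"
        unfolding d\<psi> by (simp add: abs_mult[symmetric] left_diff_distrib)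
      then show "norm (\<bar>u' x - deriv (?\<psi> n) x\<bar> powr p) \<le> \<bar>u' x\<bar> powr p" using p by (simp add: powr_mono2)
    qed
  qed auto
  then have l2: "(\<lambda>n. Lp_norm p (\<lambda>x. u' x - deriv (?\<psi> n) x)) \<longlonglongrightarrow> 0"
    unfolding Lp_norm_def using p by (intro powr_tendsto_0) auto
  have eq: "Lp_norm p (wderiv (\<lambda>x. u x - ?\<psi> n x)) = Lp_norm p (\<lambda>x. u' x - deriv (?\<psi> n) x)" for n
  proof (rule Lp_norm_cong_AE)
    have h: "has_weak_deriv (\<lambda>x. u x - ?\<psi> n x) (\<lambda>x. u' x - deriv (?\<psi> n) x)"
      by (rule has_weak_deriv_diff[OF wd has_weak_deriv_Cc1[OF \<psi>]])
    show "AE x in I01. wderiv (\<lambda>x. u x - ?\<psi> n x) x = u' x - deriv (?\<psi> n) x"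
      by (rule wderiv(2)[OF h])
    show "wderiv (\<lambda>x. u x - ?\<psi> n x) \<in> borel_measurable I01"
      "(\<lambda>x. u' x - deriv (?\<psi> n) x) \<in> borel_measurable I01"
      using h wderiv(1)[OF h] by (auto simp: has_weak_deriv_def)
  qed
  have "(\<lambda>n. W1p_norm p (\<lambda>x. u x - ?\<psi> n x)) \<longlonglongrightarrow> 0 + 0"
    unfolding W1p_norm_def eq by (intro tendsto_add l1 l2)
  then show "u \<in> W01p p"
    unfolding W01p_def W1p_def using L wd \<psi> cu
    by (auto intro!: exI[of _ ?\<psi>] intro: continuous_on_subset simp del: mult_1_right)
qed

section \<open>The shooting problem\<close>

text \<open>\<open>F\<close> stands for \<open>f\<close>, extended constantly to negative first
  arguments so as to be continuous on the whole plane. \<open>F_scale\<close> is the weak inequality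
  drawn from (H3), for all positive scales.\<close>

locale shooting =
  fixes p :: real and F :: "real \<Rightarrow> real \<Rightarrow> real"
  assumes p: "1 < p"
    and F_cont: "continuous_on UNIV (\<lambda>(x, y). F x y)"
    and F_nonneg: "0 \<le> F x y"
    and F_mono: "x \<le> x' \<Longrightarrow> F x y \<le> F x' y"
    and F_antimono: "0 \<le> y \<Longrightarrow> y \<le> y' \<Longrightarrow> F x y' \<le> F x y"
    and F_scale: "0 < s \<Longrightarrow> s \<le> t \<Longrightarrow> 0 < x \<Longrightarrow>
      F (s * x) (s * y) \<le> (s / t) powr (p - 1) * F (t * x) (t * y)"
begin

text \<open>This inverts the power \<open>p - 1\<close> on nonnegative values; the cut-off at
  \<open>0\<close> keeps the height nondecreasing even where the flux \<open>z\<close> is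
  negative.\<close>

definition slope :: "(real \<Rightarrow> real) \<Rightarrow> real \<Rightarrow> real" where
  "slope z t = max 0 (z t) powr (1 / (p - 1))"

definition height :: "(real \<Rightarrow> real) \<Rightarrow> real \<Rightarrow> real" where
  "height z t = integral {0..t} (slope z)"

text \<open>Integral form of the flux equation: trajectories with initial slope \<open>a\<close> are
  the fixed points of \<open>shoot a\<close>.\<close>

definition shoot :: "real \<Rightarrow> (real \<Rightarrow> real) \<Rightarrow> real \<Rightarrow> real" where
  "shoot a z t = a powr (p - 1) - integral {0..t} (\<lambda>s. F (height z s) (slope z s))"

lemma slope_nonneg [simp]: "0 \<le> slope z t"
  by (simp add: slope_def)

lemma slope_le: "z t \<le> b powr (p - 1) \<Longrightarrow> 0 \<le> b \<Longrightarrow> slope z t \<le> b"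
  unfolding slope_def using p
  by (rule_tac order_trans[OF powr_mono2[of _ _ "b powr (p - 1)"]]) (auto simp: powr_powr)

lemma continuous_on_slope: "continuous_on S z \<Longrightarrow> continuous_on S (slope z)"
  unfolding slope_def[abs_def] using p by (intro continuous_on_powr' continuous_intros) auto

lemma continuous_on_F:
  assumes "continuous_on S u" "continuous_on S g"
  shows "continuous_on S (\<lambda>s. F (u s) (g s))"
  using continuous_on_compose2[OF F_cont, of S "\<lambda>s. (u s, g s)"] assms
  by (auto intro!: continuous_intros)

context
  fixes z :: "real \<Rightarrow> real" assumes z: "continuous_on {0..1/2} z"
begin

lemma slope_integrable: "0 \<le> s \<Longrightarrow> t \<le> 1/2 \<Longrightarrow> slope z integrable_on {s..t}"
  using z by (intro integrable_continuous_real continuous_on_slope) (auto intro: continuous_on_subset)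

lemma continuous_on_height: "continuous_on {0..1/2} (height z)"
  unfolding height_def[abs_def] by (intro indefinite_integral_continuous_1 slope_integrable) auto

lemma continuous_on_rhs: "continuous_on {0..1/2} (\<lambda>s. F (height z s) (slope z s))"
  by (intro continuous_on_F continuous_on_height continuous_on_slope z)

lemma rhs_integrable: "0 \<le> s \<Longrightarrow> t \<le> 1/2 \<Longrightarrow> (\<lambda>s. F (height z s) (slope z s)) integrable_on {s..t}"
  by (rule integrable_continuous_real, rule continuous_on_subset[OF continuous_on_rhs]) auto

lemma continuous_on_shoot: "continuous_on {0..1/2} (shoot a z)"
  unfolding shoot_def[abs_def]
  by (intro continuous_intros indefinite_integral_continuous_1 rhs_integrable) auto

lemma height_nonneg: "0 \<le> t \<Longrightarrow> t \<le> 1/2 \<Longrightarrow> 0 \<le> height z t"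
  unfolding height_def by (intro integral_nonneg slope_integrable) auto

lemma shoot_diff:
  assumes "0 \<le> s" "s \<le> t" "t \<le> 1/2"
  shows "shoot a z s - shoot a z t = integral {s..t} (\<lambda>s. F (height z s) (slope z s))"
  using Henstock_Kurzweil_Integration.integral_combine[OF assms(1,2) rhs_integrable[of 0 t]] assms
  by (simp add: shoot_def)

lemma shoot_le: "0 \<le> t \<Longrightarrow> t \<le> 1/2 \<Longrightarrow> shoot a z t \<le> a powr (p - 1)"
  unfolding shoot_def by (simp add: integral_nonneg rhs_integrable F_nonneg)

context
  fixes b :: real assumes b: "0 \<le> b" "\<And>t. 0 \<le> t \<Longrightarrow> t \<le> 1/2 \<Longrightarrow> z t \<le> b powr (p - 1)"
begin

lemma height_le:
  assumes "0 \<le> t" "t \<le> 1/2"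
  shows "height z t \<le> b"
proof -
  have "height z t \<le> integral {0..t} (\<lambda>_. b)"
    unfolding height_def by (intro integral_le slope_integrable slope_le b) (use assms in auto)
  also have "\<dots> \<le> b" using assms b(1) mult_right_mono[of t 1 b] by simp
  finally show ?thesis .
qed

lemma rhs_le:
  assumes "0 \<le> t" "t \<le> 1/2"
  shows "F (height z t) (slope z t) \<le> F b 0"
  using F_mono[OF height_le[OF assms]] F_antimono[of 0 "slope z t" b]
  by (meson order_refl order_trans slope_nonneg F_antimono)

text \<open>A height of at most \<open>b\<close> and a nonnegative slope bound the right-hand side
  by \<open>F b 0\<close>. The constant depends on \<open>z\<close> only through \<open>b\<close>,
  which makes the approximations equicontinuous.\<close>

lemma shoot_lipschitz:
  assumes "0 \<le> s" "s \<le> t" "t \<le> 1/2"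
  shows "\<bar>shoot a z s - shoot a z t\<bar> \<le> F b 0 * (t - s)"
proof -
  have "integral {s..t} (\<lambda>s. F (height z s) (slope z s)) \<le> integral {s..t} (\<lambda>_. F b 0)"
    by (intro integral_le rhs_integrable rhs_le) (use assms in auto)
  moreover have "0 \<le> integral {s..t} (\<lambda>s. F (height z s) (slope z s))"
    by (intro integral_nonneg rhs_integrable F_nonneg) (use assms in auto)
  ultimately show ?thesis using assms by (simp add: shoot_diff mult.commute)
qed

end
end

text \<open>Causality: heights and right-hand sides up to \<open>t\<close> see only the flux up to
  \<open>t\<close>. The step-by-step solution of the delayed equation rests on this.\<close>

lemma shoot_cong:
  assumes "\<And>s. 0 \<le> s \<Longrightarrow> s \<le> t \<Longrightarrow> z s = w s"
  shows "shoot a z t = shoot a w t"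
proof -
  have sl: "slope z s = slope w s" if "s \<in> {0..t}" for s using assms that by (simp add: slope_def)
  have "height z s = height w s" if "s \<in> {0..t}" for s
    unfolding height_def using that by (intro integral_cong sl) auto
  then show ?thesis unfolding shoot_def using sl by (auto intro!: integral_cong)
qed

text \<open>Pointwise convergence is enough, because \<open>b\<close> dominates the slopes and
  \<open>F b 0\<close> the right-hand sides; dominated convergence is applied first to the heights
  and then to the flux.\<close>

lemma shoot_tendsto:
  assumes w: "\<And>j::nat. continuous_on {0..1/2} (w j)"
    and le: "\<And>j t. 0 \<le> t \<Longrightarrow> t \<le> 1/2 \<Longrightarrow> w j t \<le> b powr (p - 1)" and b: "0 \<le> b"
    and lim: "\<And>t. 0 \<le> t \<Longrightarrow> t \<le> 1/2 \<Longrightarrow> (\<lambda>j. w j t) \<longlonglongrightarrow> z t"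
    and a: "\<alpha> \<longlonglongrightarrow> a" "a > 0" and t: "0 \<le> t" "t \<le> 1/2"
  shows "(\<lambda>j. shoot (\<alpha> j) (w j) t) \<longlonglongrightarrow> shoot a z t"
proof -
  have sl: "(\<lambda>j. slope (w j) s) \<longlonglongrightarrow> slope z s" if "0 \<le> s" "s \<le> 1/2" for s
    unfolding slope_def using p that by (intro tendsto_powr' tendsto_intros lim) auto
  have hl: "(\<lambda>j. height (w j) s) \<longlonglongrightarrow> height z s" if "0 \<le> s" "s \<le> 1/2" for s
    unfolding height_def
  proof (rule dominated_convergence)
    show "slope (w k) integrable_on {0..s}" for k by (rule slope_integrable[OF w]) (use that in auto)
    show "(\<lambda>_. b) integrable_on {0..s}" by (rule integrable_const_ivl)
    show "norm (slope (w k) x) \<le> b" if x: "x \<in> {0..s}" for k x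
      using slope_le[of "w k" x b] le[where j=k and t=x] b x \<open>s \<le> 1/2\<close> by simp
    show "(\<lambda>k. slope (w k) x) \<longlonglongrightarrow> slope z x" if x: "x \<in> {0..s}" for x
      using sl x \<open>s \<le> 1/2\<close> by simp
  qed
  have Fl: "(\<lambda>j. F (height (w j) s) (slope (w j) s)) \<longlonglongrightarrow> F (height z s) (slope z s)"
    if "0 \<le> s" "s \<le> 1/2" for s
  proof -
    have "isCont (\<lambda>(x, y). F x y) (height z s, slope z s)"
      using F_cont by (simp add: continuous_on_eq_continuous_at)
    from isCont_tendsto_compose[OF this tendsto_Pair[OF hl[OF that] sl[OF that]]]
    show ?thesis by simp
  qed
  have "(\<lambda>j. integral {0..t} (\<lambda>s. F (height (w j) s) (slope (w j) s)))
      \<longlonglongrightarrow> integral {0..t} (\<lambda>s. F (height z s) (slope z s))"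
  proof (rule dominated_convergence)
    show "(\<lambda>s. F (height (w k) s) (slope (w k) s)) integrable_on {0..t}" for k
      by (rule rhs_integrable[OF w]) (use t in auto)
    show "(\<lambda>_. F b 0) integrable_on {0..t}" by (rule integrable_const_ivl)
    show "norm (F (height (w k) x) (slope (w k) x)) \<le> F b 0" if x: "x \<in> {0..t}" for k x
      using rhs_le[OF w b le, of x k] F_nonneg x t by simp
    show "(\<lambda>k. F (height (w k) x) (slope (w k) x)) \<longlonglongrightarrow> F (height z x) (slope z x)" if x: "x \<in> {0..t}" for x
      using Fl x t by simp
  qed
  moreover have "(\<lambda>j. \<alpha> j powr (p - 1)) \<longlonglongrightarrow> a powr (p - 1)"
    using a by (intro tendsto_intros) auto
  ultimately show ?thesis unfolding shoot_def by (intro tendsto_diff)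
qed

text \<open>Tonelli's approximations: the delay \<open>h\<close> makes the equation solvable step by step, so that the
  \<open>k\<close>-th iterate already solves the delayed equation on \<open>[0, k h]\<close>.\<close>

definition delay :: "real \<Rightarrow> (real \<Rightarrow> real) \<Rightarrow> real \<Rightarrow> real" where
  "delay h z t = z (max 0 (t - h))"

primrec iterate :: "real \<Rightarrow> real \<Rightarrow> nat \<Rightarrow> real \<Rightarrow> real" where
  "iterate a h 0 = (\<lambda>_. a powr (p - 1))"
| "iterate a h (Suc k) = shoot a (delay h (iterate a h k))"

lemma delay_range: "0 \<le> h \<Longrightarrow> t \<le> 1/2 \<Longrightarrow> max 0 (t - h) \<in> {0..1/2::real}"
  by (auto simp: max_def)

lemma continuous_on_delay:
  assumes "continuous_on {0..1/2} z" "0 \<le> h"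
  shows "continuous_on {0..1/2} (delay h z)"
  unfolding delay_def[abs_def]
  by (rule continuous_on_compose2[OF assms(1)]) (use delay_range assms in \<open>auto intro!: continuous_intros simp del: max.bounded_iff\<close>)

lemma continuous_on_iterate:
  assumes "0 \<le> h" shows "continuous_on {0..1/2} (iterate a h k)"
  by (induction k) (auto intro!: continuous_on_shoot continuous_on_delay assms)

lemma iterate_le:
  assumes "0 \<le> h" "0 \<le> t" "t \<le> 1/2"
  shows "iterate a h k t \<le> a powr (p - 1)"
  using assms by (cases k) (auto intro!: shoot_le continuous_on_delay continuous_on_iterate)

lemma delay_iterate_le:
  assumes "0 \<le> h" "0 \<le> t" "t \<le> 1/2" "0 \<le> a" "a \<le> b"
  shows "delay h (iterate a h k) t \<le> b powr (p - 1)"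
proof -
  have "iterate a h k (max 0 (t - h)) \<le> a powr (p - 1)"
    using delay_range[of h t] assms by (intro iterate_le) auto
  also have "\<dots> \<le> b powr (p - 1)" using assms p by (intro powr_mono2) auto
  finally show ?thesis by (simp add: delay_def)
qed

text \<open>For times up to \<open>(k + 1) h\<close> the delayed argument does not exceed
  \<open>k h\<close>, where the previous two iterates agree already; causality carries the agreement
  one delay further.\<close>

lemma iterate_stable:
  assumes h: "0 \<le> h" and t: "0 \<le> t" "t \<le> real k * h"
  shows "iterate a h (Suc k) t = iterate a h k t"
  using t
proof (induction k arbitrary: t)
  case 0
  then show ?case by (simp add: shoot_def)
next
  case (Suc k)
  have "shoot a (delay h (iterate a h (Suc k))) t = shoot a (delay h (iterate a h k)) t"
  proof (rule shoot_cong)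
    fix s assume "0 \<le> s" "s \<le> t"
    then show "delay h (iterate a h (Suc k)) s = delay h (iterate a h k) s"
      unfolding delay_def using Suc.prems h by (intro Suc.IH) (auto simp: algebra_simps)
  qed
  then show ?case by simp
qed

text \<open>An iterate is built by finitely many applications of \<open>shoot\<close>, each stable
  under pointwise limits, so continuity in the initial slope follows without uniqueness of
  solutions.\<close>

lemma iterate_tendsto:
  assumes h: "0 \<le> h" and \<alpha>: "\<alpha> \<longlonglongrightarrow> a" "a > 0" "\<And>j. 0 \<le> \<alpha> j" "\<And>j. \<alpha> j \<le> b" and t: "0 \<le> t" "t \<le> 1/2"
  shows "(\<lambda>j. iterate (\<alpha> j) h k t) \<longlonglongrightarrow> iterate a h k t"
  using t
proof (induction k arbitrary: t)
  case 0
  then show ?case using \<alpha> by (auto intro!: tendsto_intros)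
next
  case (Suc k)
  have b: "0 \<le> b" using \<alpha>(3,4) order_trans by blast
  show ?case
    unfolding iterate.simps
  proof (rule shoot_tendsto[where b=b])
    show "(\<lambda>j. delay h (iterate (\<alpha> j) h k) s) \<longlonglongrightarrow> delay h (iterate a h k) s" if "0 \<le> s" "s \<le> 1/2" for s
      unfolding delay_def using delay_range[OF h that(2)] by (intro Suc.IH) auto
  qed (use Suc.prems h \<alpha> b in \<open>auto intro!: continuous_on_delay continuous_on_iterate delay_iterate_le\<close>)
qed

text \<open>The two equations say that the end value vanishes unless \<open>a\<close> is an end point of the range with the
  corresponding sign; in this form the alternative survives the passage to the limit.\<close>

lemma shooting_approx:
  assumes a: "0 < a0" "a0 \<le> a1" and h: "0 \<le> h"
  shows "\<exists>a\<in>{a0..a1}. max 0 (iterate a h k (1/2)) * (a1 - a) = 0 \<and> min 0 (iterate a h k (1/2)) * (a - a0) = 0"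
proof -
  let ?E = "\<lambda>a. iterate a h k (1/2)"
  consider "?E a0 \<le> 0" | "?E a1 \<ge> 0" | "?E a0 > 0" "?E a1 < 0" by linarith
  then show ?thesis
  proof cases
    case 1 then show ?thesis using a by (intro bexI[of _ a0]) auto
  next
    case 2 then show ?thesis using a by (intro bexI[of _ a1]) auto
  next
    case 3
    have "continuous_on {a0..a1} ?E"
      unfolding continuous_on_sequentially
    proof (intro allI ballI impI, elim conjE)
      fix x a assume x: "a \<in> {a0..a1}" "\<forall>n. x n \<in> {a0..a1}" "x \<longlonglongrightarrow> a"
      then show "(?E \<circ> x) \<longlonglongrightarrow> ?E a"
        unfolding comp_def using a h
        by (intro iterate_tendsto[where b=a1]) (auto intro: order_trans[OF less_imp_le])
    qed
    then obtain x where "a0 \<le> x" "x \<le> a1" "?E x = 0"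
      using IVT2'[of ?E a1 0 a0] 3 a by auto
    then show ?thesis by (intro bexI[of _ x]) auto
  qed
qed

lemma shooting_limit:
  assumes a: "0 < a0" "a0 \<le> a1"
  obtains a z where "a0 \<le> a" "a \<le> a1" "continuous_on {0..1/2} z"
    "\<And>t. 0 \<le> t \<Longrightarrow> t \<le> 1/2 \<Longrightarrow> z t = shoot a z t"
    "max 0 (z (1/2)) * (a1 - a) = 0" "min 0 (z (1/2)) * (a - a0) = 0"
proof -
  \<comment> \<open>With this delay the iterate of index \<open>Suc n\<close> covers exactly
    \<open>[0, 1/2]\<close>, so it solves the delayed equation on the whole half interval.\<close>
  define h where "h n = 1 / (2 * real (Suc n))" for n
  have h: "h n > 0" "real (Suc n) * h n = 1/2" for n by (auto simp: h_def field_simps)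
  have h0: "h \<longlonglongrightarrow> 0"
    using tendsto_mult_right_zero[OF LIMSEQ_inverse_real_of_nat, of "1/2"]
    by (simp add: h_def[abs_def] inverse_eq_divide)
  have "\<exists>\<alpha>. \<forall>n. \<alpha> n \<in> {a0..a1} \<and> max 0 (iterate (\<alpha> n) (h n) (Suc n) (1/2)) * (a1 - \<alpha> n) = 0
      \<and> min 0 (iterate (\<alpha> n) (h n) (Suc n) (1/2)) * (\<alpha> n - a0) = 0"
    using shooting_approx[OF a less_imp_le[OF h(1)]] by (intro choice) blast
  then obtain \<alpha> where \<alpha>: "\<And>n. a0 \<le> \<alpha> n" "\<And>n. \<alpha> n \<le> a1"
    and end1: "\<And>n. max 0 (iterate (\<alpha> n) (h n) (Suc n) (1/2)) * (a1 - \<alpha> n) = 0"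
    and end2: "\<And>n. min 0 (iterate (\<alpha> n) (h n) (Suc n) (1/2)) * (\<alpha> n - a0) = 0"
    by auto
  define Y where "Y n = iterate (\<alpha> n) (h n) (Suc n)" for n
  define C where "C = F a1 0"
  have C: "C \<ge> 0" by (simp add: C_def F_nonneg)
  have \<alpha>0: "0 \<le> \<alpha> n" for n using \<alpha>(1)[of n] a by linarith
  have Yc: "continuous_on {0..1/2} (Y n)" for n
    unfolding Y_def by (intro continuous_on_iterate less_imp_le h)
  have Yeq: "Y n t = shoot (\<alpha> n) (delay (h n) (Y n)) t" if "0 \<le> t" "t \<le> 1/2" for n t
    using iterate_stable[of "h n" t "Suc n" "\<alpha> n"] that h[of n] unfolding Y_def by simp
  have dYc: "continuous_on {0..1/2} (delay (h n) (Y n))" for n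
    by (intro continuous_on_delay Yc less_imp_le h)
  have dYle: "delay (h n) (Y n) t \<le> a1 powr (p - 1)" if "0 \<le> t" "t \<le> 1/2" for n t
    unfolding Y_def by (rule delay_iterate_le) (use that h(1)[of n] \<alpha>0 \<alpha> in \<open>auto simp: less_imp_le\<close>)
  have lip: "\<bar>Y n s - Y n t\<bar> \<le> C * \<bar>t - s\<bar>" if "0 \<le> s" "s \<le> 1/2" "0 \<le> t" "t \<le> 1/2" for n s t
  proof -
    have "\<bar>Y n s - Y n t\<bar> \<le> C * (t - s)" if "0 \<le> s" "s \<le> t" "t \<le> 1/2" for s t
      using shoot_lipschitz[OF dYc _ dYle, of s t "\<alpha> n" n] that a Yeq[of s n] Yeq[of t n]
      by (simp add: C_def)
    from this[of s t] this[of t s] show ?thesis using that by (cases "s \<le> t") (auto simp: abs_minus_commute)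
  qed
  have Y0: "Y n 0 = \<alpha> n powr (p - 1)" for n using Yeq[of 0 n] by (simp add: shoot_def)
  obtain z k where z: "continuous_on {0..1/2} z" and k: "strict_mono (k :: nat \<Rightarrow> nat)"
    and unif: "\<And>e. 0 < e \<Longrightarrow> \<exists>N. \<forall>n x. n \<ge> N \<and> x \<in> {0..1/2} \<longrightarrow> norm (Y (k n) x - z x) < e"
  proof (rule Arzela_Ascoli[of "{0..1/2}" Y "a1 powr (p - 1) + C"])
    show "norm (Y n x) \<le> a1 powr (p - 1) + C" if "x \<in> {0..1/2}" for n x
    proof -
      have "\<bar>Y n 0 - Y n x\<bar> \<le> C * x" using lip[of 0 x n] that by simp
      also have "\<dots> \<le> C * 1" using C that by (intro mult_left_mono) auto
      finally have "\<bar>Y n x\<bar> \<le> \<bar>Y n 0\<bar> + C" by simp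
      also have "\<bar>Y n 0\<bar> \<le> a1 powr (p - 1)" using Y0 \<alpha> \<alpha>0 p by (simp add: powr_mono2)
      finally show ?thesis by simp
    qed
    show "\<exists>d>0. \<forall>n y. y \<in> {0..1/2} \<and> norm (x - y) < d \<longrightarrow> norm (Y n x - Y n y) < e"
      if x: "x \<in> {0..1/2}" and e: "0 < e" for x e
    proof (intro exI[of _ "e / (C + 1)"] conjI allI impI)
      show "0 < e / (C + 1)" using e C by simp
      fix n y assume y: "y \<in> {0..1/2} \<and> norm (x - y) < e / (C + 1)"
      have "\<bar>Y n x - Y n y\<bar> \<le> C * \<bar>y - x\<bar>" using lip x y by auto
      also have "\<dots> \<le> (C + 1) * \<bar>x - y\<bar>" using C by (simp add: abs_minus_commute mult_right_mono)
      also have "\<dots> < e" using y C by (simp add: less_divide_eq mult.commute)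
      finally show "norm (Y n x - Y n y) < e" by simp
    qed
  qed auto
  have Yl: "(\<lambda>j. Y (k j) t) \<longlonglongrightarrow> z t" if "0 \<le> t" "t \<le> 1/2" for t
    unfolding LIMSEQ_iff using unif that by fastforce
  \<comment> \<open>The initial slopes are recovered from the initial fluxes by a continuous
    function, so they converge along the same subsequence.\<close>
  define b where "b = z 0 powr (1 / (p - 1))"
  have "z 0 \<ge> a0 powr (p - 1)"
    using Y0 \<alpha> a p by (intro LIMSEQ_le_const[OF Yl]) (auto simp: powr_mono2)
  moreover have "a0 powr (p - 1) > 0" using a by simp
  ultimately have z0: "z 0 > 0" by linarith
  have "(\<lambda>j. Y (k j) 0 powr (1 / (p - 1))) \<longlonglongrightarrow> b"
    unfolding b_def using z0 by (intro tendsto_intros Yl) auto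
  moreover have "Y (k j) 0 powr (1 / (p - 1)) = \<alpha> (k j)" for j
    using Y0 \<alpha>0 p by (simp add: powr_powr)
  ultimately have bl: "(\<lambda>j. \<alpha> (k j)) \<longlonglongrightarrow> b" by simp
  have b: "a0 \<le> b" "b \<le> a1"
    using \<alpha> by (auto intro: LIMSEQ_le_const[OF bl] LIMSEQ_le_const2[OF bl])
  have hk: "(\<lambda>j. h (k j)) \<longlonglongrightarrow> 0" using LIMSEQ_subseq_LIMSEQ[OF h0 k] by (simp add: comp_def)
  \<comment> \<open>The delay moves the argument by at most \<open>h (k j)\<close>; the uniform
    Lipschitz bound turns this into an error that tends to zero.\<close>
  have dl: "(\<lambda>j. delay (h (k j)) (Y (k j)) t) \<longlonglongrightarrow> z t" if t: "0 \<le> t" "t \<le> 1/2" for t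
  proof -
    have "(\<lambda>j. delay (h (k j)) (Y (k j)) t - Y (k j) t) \<longlonglongrightarrow> 0"
    proof (rule Lim_null_comparison)
      show "\<forall>\<^sub>F j in sequentially. norm (delay (h (k j)) (Y (k j)) t - Y (k j) t) \<le> C * h (k j)"
      proof (rule always_eventually, rule allI)
        fix j
        let ?h = "h (k j)"
        have "\<bar>delay ?h (Y (k j)) t - Y (k j) t\<bar> \<le> C * \<bar>t - max 0 (t - ?h)\<bar>"
          unfolding delay_def using t delay_range[of ?h t] h(1)[of "k j"] by (intro lip) auto
        also have "\<dots> \<le> C * ?h" using t h(1)[of "k j"] C by (intro mult_left_mono) auto
        finally show "norm (delay ?h (Y (k j)) t - Y (k j) t) \<le> C * ?h" by simp
      qed
      show "(\<lambda>j. C * h (k j)) \<longlonglongrightarrow> 0" by (rule tendsto_mult_right_zero[OF hk])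
    qed
    from tendsto_add[OF this Yl[OF t]] show ?thesis by simp
  qed
  have zeq: "z t = shoot b z t" if t: "0 \<le> t" "t \<le> 1/2" for t
  proof (rule LIMSEQ_unique[OF Yl[OF t]])
    have "(\<lambda>j. shoot (\<alpha> (k j)) (delay (h (k j)) (Y (k j))) t) \<longlonglongrightarrow> shoot b z t"
      by (rule shoot_tendsto[where b=a1]) (use dYc dYle dl bl b a t in auto)
    then show "(\<lambda>j. Y (k j) t) \<longlonglongrightarrow> shoot b z t" using Yeq t by simp
  qed
  have l1: "(\<lambda>j. max 0 (Y (k j) (1/2)) * (a1 - \<alpha> (k j))) \<longlonglongrightarrow> max 0 (z (1/2)) * (a1 - b)"
    and l2: "(\<lambda>j. min 0 (Y (k j) (1/2)) * (\<alpha> (k j) - a0)) \<longlonglongrightarrow> min 0 (z (1/2)) * (b - a0)"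
    by (intro tendsto_intros Yl bl; simp)+
  have "max 0 (z (1/2)) * (a1 - b) = 0"
    by (rule LIMSEQ_unique[OF l1]) (simp only: end1[folded Y_def] tendsto_const)
  moreover have "min 0 (z (1/2)) * (b - a0) = 0"
    by (rule LIMSEQ_unique[OF l2]) (simp only: end2[folded Y_def] tendsto_const)
  ultimately show thesis using that[OF b z zeq] by blast
qed

end

section \<open>A priori estimates\<close>

lemma antiderivative:
  fixes h :: "real \<Rightarrow> real"
  assumes "continuous_on UNIV h"
  obtains H where "\<And>x. (H has_real_derivative h x) (at x)" "\<And>t. 0 \<le> t \<Longrightarrow> H t = integral {0..t} h"
proof -
  \<comment> \<open>The integral from \<open>0\<close> alone would in general have no two-sided
    derivative at \<open>0\<close>; an antiderivative on the whole line is taken instead and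
    normalised to vanish at \<open>0\<close>.\<close>
  have "\<exists>F. \<forall>x::real. -\<infinity> < ereal x \<longrightarrow> ereal x < \<infinity> \<longrightarrow> (F has_vector_derivative h x) (at x)"
    using assms by (intro einterval_antiderivative) (auto simp: continuous_on_eq_continuous_at)
  then obtain G where G: "\<And>x. (G has_real_derivative h x) (at x)"
    by (auto simp: has_real_derivative_iff_has_vector_derivative)
  show thesis
  proof (rule that[of "\<lambda>x. G x - G 0"])
    show "((\<lambda>x. G x - G 0) has_real_derivative h x) (at x)" for x
      using DERIV_diff[OF G DERIV_const] by simp
    fix t :: real assume t: "0 \<le> t"
    have "(h has_integral (G t - G 0)) {0..t}"
      using t G by (intro fundamental_theorem_of_calculus)
        (auto simp: has_real_derivative_iff_has_vector_derivative intro: has_vector_derivative_at_within)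
    then show "G t - G 0 = integral {0..t} h" by (simp add: integral_unique)
  qed
qed

text \<open>The derivative of \<open>H x + c * H (1 - x)\<close> cancels, so this combination is
  constant. The condition on \<open>c\<close> allows \<open>1\<close> and \<open>-1\<close>: with
  \<open>1\<close>, an even \<open>h\<close> makes \<open>H\<close> odd about its middle value; with
  \<open>-1\<close>, an odd \<open>h\<close> makes \<open>H\<close> even.\<close>

lemma antisymmetric_if_symmetric_derivative:
  fixes H h :: "real \<Rightarrow> real"
  assumes d: "\<And>x. (H has_real_derivative h x) (at x)" and s: "\<And>x. h (1 - x) = c * h x" and c: "c * c = 1"
  shows "H x + c * H (1 - x) = (1 + c) * H (1/2)"
proof -
  have 0: "((\<lambda>x. 1 - x) has_real_derivative - 1) (at x)" for x :: real
    by (auto intro!: derivative_eq_intros)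
  have 1: "((\<lambda>x. H (1 - x)) has_real_derivative - h (1 - x)) (at x)" for x
    using DERIV_chain'[OF 0 d] by simp
  have "h x + c * - h (1 - x) = 0" for x
    using c by (simp add: s mult.assoc[symmetric])
  then have "((\<lambda>x. H x + c * H (1 - x)) has_real_derivative 0) (at x)" for x
    using DERIV_add[OF d DERIV_cmult[OF 1]] by metis
  then have "H x + c * H (1 - x) = H (1/2) + c * H (1 - 1/2)"
    using DERIV_isconst_all[of "\<lambda>x. H x + c * H (1 - x)" x "1/2"] by blast
  then show ?thesis by (simp add: distrib_right)
qed

lemma integral_symmetric:
  fixes k :: "real \<Rightarrow> real"
  assumes c: "continuous_on UNIV k" and s: "\<And>x. k (1 - x) = k x"
  shows "integral {0..1} k = 2 * integral {0..1/2} k"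
proof -
  obtain H where H: "\<And>x. (H has_real_derivative k x) (at x)" "\<And>t. 0 \<le> t \<Longrightarrow> H t = integral {0..t} k"
    using antiderivative[OF c] by blast
  show ?thesis
    using antisymmetric_if_symmetric_derivative[OF H(1), of 1 0] s H(2)[of 0] H(2)[of 1] H(2)[of "1/2"] by simp
qed

section \<open>The function \<open>phi\<close> and its integral\<close>

lemma continuous_on_phi_integrand:
  fixes p :: real
  shows "1 < p \<Longrightarrow> continuous_on {0..1/2} (\<lambda>s. (1 - 2 * s) powr (1 / (p - 1)))"
  by (intro continuous_on_powr' continuous_intros) auto

lemma phi_integrand_integrable:
  fixes p s t :: real
  shows "1 < p \<Longrightarrow> 0 \<le> s \<Longrightarrow> t \<le> 1/2 \<Longrightarrow> (\<lambda>s. (1 - 2 * s) powr (1 / (p - 1))) integrable_on {s..t}"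
  by (rule integrable_continuous_real, rule continuous_on_subset[OF continuous_on_phi_integrand]) auto

lemma continuous_on_phi: "1 < p \<Longrightarrow> continuous_on {0..1/2} (phi p)"
  unfolding phi_def[abs_def] by (intro indefinite_integral_continuous_1 phi_integrand_integrable) auto

lemma phi_mono:
  assumes "1 < p" "0 \<le> s" "s \<le> t" "t \<le> 1/2"
  shows "phi p s \<le> phi p t"
  unfolding phi_def using assms by (intro integral_subset_le phi_integrand_integrable) auto

lemma phi_pos:
  assumes "1 < p" "0 < t" "t \<le> 1/2"
  shows "0 < phi p t"
proof -
  have "phi p t \<noteq> 0"
  proof
    assume "phi p t = 0"
    then have "\<forall>x\<in>{0..t}. (1 - 2 * x) powr (1 / (p - 1)) = 0"
      unfolding phi_def using assms
      by (subst (asm) integral_eq_0_iff) (auto intro: continuous_on_subset[OF continuous_on_phi_integrand])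
    then show False using assms(2) by force
  qed
  moreover have "0 \<le> phi p t"
    unfolding phi_def using assms by (intro integral_nonneg phi_integrand_integrable) auto
  ultimately show ?thesis by simp
qed

lemma phi_integrable: "1 < p \<Longrightarrow> 0 \<le> s \<Longrightarrow> t \<le> 1/2 \<Longrightarrow> phi p integrable_on {s..t}"
  by (rule integrable_continuous_real, rule continuous_on_subset[OF continuous_on_phi]) auto

lemma integral_phi_pos:
  assumes "1 < p" "0 < \<beta>" "\<beta> < 1/2"
  shows "0 < integral {\<beta>..1/2} (phi p)"
proof -
  have "0 < (1/2 - \<beta>) * phi p \<beta>" using assms phi_pos[of p \<beta>] by simp
  also have "\<dots> = integral {\<beta>..1/2} (\<lambda>_. phi p \<beta>)" using assms by simp
  also have "\<dots> \<le> integral {\<beta>..1/2} (phi p)"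
    using assms by (intro integral_le phi_integrable phi_mono) auto
  finally show ?thesis .
qed

section \<open>Monotonicity, amplitude and lower bounds of trajectories\<close>

context shooting
begin

text \<open>For trajectories with \<open>z (1/2) \<le> 0\<close> this is the norm of the even
  reflection of the height. Only the half interval enters, so that it can be estimated for either
  sign of \<open>z (1/2)\<close>.\<close>

definition amplitude :: "(real \<Rightarrow> real) \<Rightarrow> real" where
  "amplitude z = (2 * integral {0..1/2} (\<lambda>t. slope z t powr p)) powr (1 / p)"

abbreviation rhs :: "(real \<Rightarrow> real) \<Rightarrow> real \<Rightarrow> real" where
  "rhs z s \<equiv> F (height z s) (slope z s)"

context
  fixes a :: real and z :: "real \<Rightarrow> real"
  assumes a: "0 < a" and z: "continuous_on {0..1/2} z"
    and zeq: "\<And>t. 0 \<le> t \<Longrightarrow> t \<le> 1/2 \<Longrightarrow> z t = shoot a z t"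
begin

lemma z_diff:
  assumes "0 \<le> s" "s \<le> t" "t \<le> 1/2"
  shows "z s - z t = integral {s..t} (rhs z)"
  using shoot_diff[OF z assms, of a] zeq[of s] zeq[of t] assms by simp

lemma z_antimono: "0 \<le> s \<Longrightarrow> s \<le> t \<Longrightarrow> t \<le> 1/2 \<Longrightarrow> z t \<le> z s"
  using z_diff[of s t] integral_nonneg[OF rhs_integrable[OF z, of s t] F_nonneg] by simp

lemma z_0: "z 0 = a powr (p - 1)"
  using zeq[of 0] by (simp add: shoot_def)

lemma slope_0: "slope z 0 = a"
  using a p by (simp add: slope_def z_0 powr_powr)

lemma slope_antimono: "0 \<le> s \<Longrightarrow> s \<le> t \<Longrightarrow> t \<le> 1/2 \<Longrightarrow> slope z t \<le> slope z s"
  unfolding slope_def using z_antimono[of s t] p by (intro powr_mono2) auto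

lemma height_mono:
  assumes "0 \<le> s" "s \<le> t" "t \<le> 1/2"
  shows "height z s \<le> height z t"
  unfolding height_def using assms by (intro integral_subset_le slope_integrable z) auto

lemma height_pos:
  assumes "0 < t" "t \<le> 1/2"
  shows "0 < height z t"
proof -
  have "height z t \<noteq> 0"
  proof
    assume "height z t = 0"
    then have "\<forall>x\<in>{0..t}. slope z x = 0"
      unfolding height_def using assms z
      by (subst (asm) integral_eq_0_iff) (auto intro: continuous_on_slope continuous_on_subset)
    then show False using assms slope_0 a by auto
  qed
  then show ?thesis using height_nonneg[OF z, of t] assms by simp
qed

text \<open>Along a trajectory the height grows and the slope falls, and \<open>F\<close> increases
  under both changes.\<close>

lemma rhs_mono:
  assumes "0 \<le> s" "s \<le> t" "t \<le> 1/2"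
  shows "rhs z s \<le> rhs z t"
  using F_mono[OF height_mono[OF assms], of "slope z s"]
    F_antimono[OF slope_nonneg slope_antimono[OF assms], of "height z t"] by linarith

lemma height_deriv:
  "t \<in> {0..1/2} \<Longrightarrow> (height z has_real_derivative slope z t) (at t within {0..1/2})"
  unfolding height_def[abs_def] by (intro integral_has_real_derivative continuous_on_slope z)

lemma z_deriv:
  assumes t: "t \<in> {0..1/2}"
  shows "(z has_real_derivative - rhs z t) (at t within {0..1/2})"
proof -
  have "(shoot a z has_real_derivative - rhs z t) (at t within {0..1/2})"
    unfolding shoot_def[abs_def]
    using DERIV_diff[OF DERIV_const integral_has_real_derivative[OF continuous_on_rhs[OF z] t]] by simp
  then show ?thesis
    by (rule has_field_derivative_transform_within[where d=1]) (use t zeq in auto)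
qed

text \<open>Where \<open>z t\<close> is nonpositive both sides vanish; elsewhere the exponents agree
  because \<open>1 + 1 / (p - 1) = p / (p - 1)\<close>.\<close>

lemma z_slope: "z t * slope z t = slope z t powr p"
proof (cases "z t > 0")
  case True
  then have "z t * slope z t = z t powr (1 + 1 / (p - 1))" by (simp add: slope_def powr_add)
  also have "1 + 1 / (p - 1) = 1 / (p - 1) * p" using p by (simp add: field_simps)
  also have "z t powr (1 / (p - 1) * p) = (z t powr (1 / (p - 1))) powr p" by (simp add: powr_powr)
  also have "\<dots> = slope z t powr p" using True by (simp add: slope_def)
  finally show ?thesis .
qed (use p in \<open>simp add: slope_def\<close>)

lemma slope_powr_integrable: "(\<lambda>t. slope z t powr p) integrable_on {0..1/2}"
  unfolding z_slope[symmetric]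
  by (intro integrable_continuous_real continuous_intros continuous_on_slope z)

lemma rhs_height_integrable:
  "0 \<le> s \<Longrightarrow> t \<le> 1/2 \<Longrightarrow> (\<lambda>t. rhs z t * height z t) integrable_on {s..t}"
  by (intro integrable_continuous_real continuous_on_subset[of "{0..1/2}" _ "{s..t}"]
      continuous_intros continuous_on_rhs continuous_on_height z) auto

text \<open>This is the equation tested with its own solution: the derivative of
  \<open>z t * height z t\<close> is integrated, and the height vanishes at
  \<open>0\<close>.\<close>

lemma energy_identity:
  "integral {0..1/2} (\<lambda>t. slope z t powr p)
    = z (1/2) * height z (1/2) + integral {0..1/2} (\<lambda>t. rhs z t * height z t)"
proof -
  have "((\<lambda>t. z t * slope z t - rhs z t * height z t) has_integral
      z (1/2) * height z (1/2) - z 0 * height z 0) {0..1/2}"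
  proof (rule fundamental_theorem_of_calculus)
    fix t :: real assume t: "t \<in> {0..1/2}"
    have "((\<lambda>t. z t * height z t) has_real_derivative z t * slope z t - rhs z t * height z t) (at t within {0..1/2})"
      using DERIV_mult[OF z_deriv[OF t] height_deriv[OF t]] by (simp add: algebra_simps)
    then show "((\<lambda>t. z t * height z t) has_vector_derivative z t * slope z t - rhs z t * height z t) (at t within {0..1/2})"
      by (simp add: has_real_derivative_iff_has_vector_derivative)
  qed simp
  then have "integral {0..1/2} (\<lambda>t. z t * slope z t - rhs z t * height z t) = z (1/2) * height z (1/2)"
    by (simp add: integral_unique height_def)
  then show ?thesis
    unfolding z_slope
    by (subst (asm) integral_diff) (auto intro: slope_powr_integrable rhs_height_integrable)
qed

lemma amplitude_powr: "amplitude z powr p = 2 * integral {0..1/2} (\<lambda>t. slope z t powr p)"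
  using p integral_nonneg[OF slope_powr_integrable] by (simp add: amplitude_def powr_powr)

lemma amplitude_le: "amplitude z \<le> a"
proof -
  have "integral {0..1/2} (\<lambda>t. slope z t powr p) \<le> integral {0..1/2::real} (\<lambda>_. a powr p)"
    using slope_antimono[of 0] slope_0 p
    by (intro integral_le slope_powr_integrable) (auto intro: powr_mono2)
  then have "2 * integral {0..1/2} (\<lambda>t. slope z t powr p) \<le> a powr p" by simp
  then have "amplitude z \<le> (a powr p) powr (1 / p)"
    unfolding amplitude_def using p integral_nonneg[OF slope_powr_integrable] by (intro powr_mono2) auto
  then show ?thesis using a p by (simp add: powr_powr)
qed

text \<open>Jensen's inequality on the half interval, whose mass \<open>1/2\<close> is below
  \<open>1\<close>; the factor \<open>2\<close> in \<open>amplitude\<close> only adds slack.\<close>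

lemma height_le_amplitude: "height z (1/2) \<le> amplitude z"
proof -
  let ?M = "lebesgue_on {0..1/2::real}"
  have c: "continuous_on {0..1/2} (slope z)" by (intro continuous_on_slope z)
  have i: "integrable ?M (slope z)" "integrable ?M (\<lambda>t. slope z t powr p)"
    unfolding z_slope[symmetric] by (intro continuous_imp_integrable_real continuous_on_mult c z)+
  have "height z (1/2) powr p = (LINT t|?M. \<bar>slope z t\<bar>) powr p"
    using lebesgue_integral_eq_integral[OF i(1)] by (simp add: height_def)
  also have "\<dots> \<le> (LINT t|?M. \<bar>slope z t\<bar> powr p)"
    using i p by (intro integral_powr_le finite_measure_lebesgue_on) (auto simp: measure_restrict_space)
  also have "\<dots> = integral {0..1/2} (\<lambda>t. slope z t powr p)"
    using lebesgue_integral_eq_integral[OF i(2)] by simp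
  also have "\<dots> \<le> amplitude z powr p"
    unfolding amplitude_powr using integral_nonneg[OF slope_powr_integrable] by simp
  finally show ?thesis
    using p powr_less_mono2[of p "amplitude z" "height z (1/2)"] by (force simp: amplitude_def)
qed

text \<open>As the right-hand side is nondecreasing, \<open>z\<close> is concave, hence lies above its chord.\<close>

lemma slope_lower:
  assumes z1: "0 \<le> z (1/2)" and t: "0 \<le> t" "t \<le> 1/2"
  shows "a * (1 - 2 * t) powr (1 / (p - 1)) \<le> slope z t"
proof -
  \<comment> \<open>The drop of \<open>z\<close> before \<open>t\<close> and the drop after
    \<open>t\<close> are both compared with \<open>rhs z t\<close>; eliminating that value yields
    the chord inequality.\<close>
  have "integral {0..t} (rhs z) \<le> integral {0..t} (\<lambda>_. rhs z t)"
    using t by (intro integral_le rhs_integrable[OF z] rhs_mono) auto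
  then have 1: "z 0 - z t \<le> t * rhs z t" using z_diff[of 0 t] t by simp
  have "integral {t..1/2} (\<lambda>_. rhs z t) \<le> integral {t..1/2} (rhs z)"
    using t by (intro integral_le rhs_integrable[OF z] rhs_mono) auto
  then have 2: "(1/2 - t) * rhs z t \<le> z t - z (1/2)" using z_diff[of t "1/2"] t by simp
  have "(1 - 2 * t) * (z 0 - z t) \<le> (1 - 2 * t) * (t * rhs z t)"
    using 1 t by (intro mult_left_mono) auto
  also have "\<dots> = 2 * t * ((1/2 - t) * rhs z t)" by (simp add: algebra_simps)
  also have "\<dots> \<le> 2 * t * (z t - z (1/2))" using 2 t by (intro mult_left_mono) auto
  also have "\<dots> \<le> 2 * t * z t" using z1 t by (intro mult_left_mono) auto
  finally have chord: "z 0 * (1 - 2 * t) \<le> z t" by (simp add: algebra_simps)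
  have "a * (1 - 2 * t) powr (1 / (p - 1)) = (z 0 * (1 - 2 * t)) powr (1 / (p - 1))"
    using a t p by (simp add: z_0 powr_mult powr_powr)
  also have "\<dots> \<le> slope z t"
    unfolding slope_def using chord t p by (intro powr_mono2) (auto simp: z_0)
  finally show ?thesis .
qed

lemma height_lower:
  assumes z1: "0 \<le> z (1/2)" and t: "0 \<le> t" "t \<le> 1/2"
  shows "a * phi p t \<le> height z t"
proof -
  have "a * phi p t = integral {0..t} (\<lambda>s. a * (1 - 2 * s) powr (1 / (p - 1)))"
    by (simp add: phi_def)
  also have "\<dots> \<le> height z t"
    unfolding height_def using t p
    by (intro integral_le slope_integrable[OF z] integrable_on_mult_right phi_integrand_integrable slope_lower[OF z1]) auto
  finally show ?thesis .
qed

text \<open>This is the lower bound required in \<open>coneK\<close>; it follows from the bound with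
  the initial slope, which the amplitude never exceeds.\<close>

lemma height_lower_amplitude:
  assumes "0 \<le> z (1/2)" "0 \<le> t" "t \<le> 1/2"
  shows "phi p t * amplitude z \<le> height z t"
proof -
  have "0 \<le> phi p t" using phi_pos[OF p, of t] assms by (cases "t = 0") (auto simp: phi_def)
  then have "phi p t * amplitude z \<le> phi p t * a" using amplitude_le by (intro mult_left_mono)
  then show ?thesis using height_lower[OF assms] by (simp add: mult.commute)
qed

text \<open>If \<open>R \<le> N\<close>, the height is at least \<open>N * phi p t\<close>, and
  scaling lifts the bound \<open>L\<close> from level \<open>R\<close> to level \<open>N\<close> on
  \<open>[\<beta>, 1/2]\<close>. The energy identity then forces
  \<open>2 * \<Phi> * L \<le> R powr (p - 1)\<close>. The number \<open>L\<close> will be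
  \<open>f_infty f (R * phi p \<beta>)\<close>, a bound valid for every slope.\<close>

lemma amplitude_less:
  assumes z1: "0 \<le> z (1/2)" and R: "0 < R" and \<beta>: "0 < \<beta>" "\<beta> < 1/2"
    and L: "\<And>y. 0 \<le> y \<Longrightarrow> L \<le> F (R * phi p \<beta>) y" "R powr (p - 1) / (2 * integral {\<beta>..1/2} (phi p)) < L"
  shows "amplitude z < R"
proof (rule ccontr)
  define N where "N = amplitude z"
  assume "\<not> amplitude z < R"
  then have N: "R \<le> N" by (simp add: N_def)
  define \<Phi> where "\<Phi> = integral {\<beta>..1/2} (phi p)"
  have \<Phi>: "0 < \<Phi>" unfolding \<Phi>_def by (rule integral_phi_pos[OF p \<beta>])
  have L0: "0 < L" using L(2) \<Phi> R by (elim less_trans[rotated]) (simp add: \<Phi>_def)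
  have lower: "(N / R) powr (p - 1) * L * N * phi p t \<le> rhs z t * height z t" if t: "\<beta> \<le> t" "t \<le> 1/2" for t
  proof -
    have u: "N * phi p t \<le> height z t"
      using height_lower_amplitude[OF z1, of t] t \<beta> by (simp add: N_def mult.commute)
    have "N * phi p \<beta> \<le> N * phi p t" using N R t \<beta> p by (intro mult_left_mono phi_mono) auto
    then have u': "N * phi p \<beta> \<le> height z t" using u by simp
    \<comment> \<open>The second argument is chosen so that rescaling from \<open>R\<close> to
      \<open>N\<close> turns it into \<open>slope z t\<close>.\<close>
    have "L \<le> F (R * phi p \<beta>) (R * (slope z t / N))" using N R by (intro L) auto
    also have "\<dots> \<le> (R / N) powr (p - 1) * F (N * phi p \<beta>) (N * (slope z t / N))"
      using N R phi_pos[OF p \<beta>(1)] \<beta> by (intro F_scale) auto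
    also have "\<dots> \<le> (R / N) powr (p - 1) * rhs z t"
      using u' N R by (auto intro!: mult_left_mono F_mono)
    finally have "(N / R) powr (p - 1) * L \<le> (N / R) powr (p - 1) * ((R / N) powr (p - 1) * rhs z t)"
      by (intro mult_left_mono) auto
    also have "\<dots> = rhs z t" using N R by (simp add: mult.assoc[symmetric] powr_mult[symmetric])
    finally have "(N / R) powr (p - 1) * L * (N * phi p t) \<le> rhs z t * height z t"
      using u N R t \<beta> phi_pos[OF p, of t] F_nonneg by (intro mult_mono) auto
    then show ?thesis by (simp add: mult.assoc)
  qed
  have "2 * \<Phi> * L * ((N / R) powr (p - 1) * N)
      = 2 * integral {\<beta>..1/2} (\<lambda>t. (N / R) powr (p - 1) * L * N * phi p t)"
    by (simp add: \<Phi>_def mult_ac)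
  also have "\<dots> \<le> 2 * integral {\<beta>..1/2} (\<lambda>t. rhs z t * height z t)"
    using \<beta> p lower by (intro mult_left_mono integral_le rhs_height_integrable integrable_on_mult_right phi_integrable) auto
  also have "\<dots> \<le> 2 * integral {0..1/2} (\<lambda>t. rhs z t * height z t)"
    using \<beta> F_nonneg height_nonneg[OF z]
    by (intro mult_left_mono integral_subset_le rhs_height_integrable) auto
  \<comment> \<open>The boundary term of the energy identity is nonnegative and is dropped.\<close>
  also have "\<dots> \<le> N powr p"
    unfolding N_def amplitude_powr energy_identity using z1 height_nonneg[OF z, of "1/2"] by simp
  also have "\<dots> = R powr (p - 1) * ((N / R) powr (p - 1) * N)"
    using N R by (simp add: powr_divide powr_diff)
  finally have "2 * \<Phi> * L \<le> R powr (p - 1)" using N R by (simp add: mult_le_cancel_right)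
  then show False using L(2) \<Phi> by (simp add: \<Phi>_def divide_less_eq mult_ac)
qed

end
end

context shooting
begin

section \<open>Even reflection and the energy along rays\<close>

text \<open>A predicate instead of a function, because \<open>U\<close> comes from the mere
  existence of an antiderivative. The conditions outside \<open>[0,1]\<close> supply the two-sided
  derivatives and the sign demanded by \<open>hump_W01p\<close>.\<close>

definition even_extension :: "(real \<Rightarrow> real) \<Rightarrow> (real \<Rightarrow> real) \<Rightarrow> (real \<Rightarrow> real) \<Rightarrow> bool" where
  "even_extension z U G \<longleftrightarrow> (\<forall>x. (U has_real_derivative G x) (at x)) \<and> continuous_on UNIV G \<and>
    (\<forall>t. 0 \<le> t \<longrightarrow> t \<le> 1/2 \<longrightarrow> U t = height z t \<and> G t = slope z t) \<and>
    (\<forall>t. U (1 - t) = U t \<and> G (1 - t) = - G t) \<and> (\<forall>s t. s \<le> t \<longrightarrow> G t \<le> G s) \<and>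
    (\<forall>t. if t \<in> {0<..<1} then 0 < U t else U t \<le> 0)"

lemma even_extensionD:
  assumes "even_extension z U G"
  shows "(U has_real_derivative G x) (at x)" "continuous_on UNIV G" "continuous_on UNIV U"
    "0 \<le> t \<Longrightarrow> t \<le> 1/2 \<Longrightarrow> U t = height z t" "0 \<le> t \<Longrightarrow> t \<le> 1/2 \<Longrightarrow> G t = slope z t"
    "U (1 - t) = U t" "G (1 - t) = - G t" "s \<le> t \<Longrightarrow> G t \<le> G s"
    "t \<in> {0<..<1} \<Longrightarrow> 0 < U t" "t \<notin> {0<..<1} \<Longrightarrow> U t \<le> 0"
  using assms DERIV_continuous_on[of UNIV U G] unfolding even_extension_def
  by (simp, simp, simp, blast, blast, blast, blast, blast, presburger, presburger)

context
  fixes a :: real and z :: "real \<Rightarrow> real"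
  assumes a: "0 < a" and z: "continuous_on {0..1/2} z"
    and zeq: "\<And>t. 0 \<le> t \<Longrightarrow> t \<le> 1/2 \<Longrightarrow> z t = shoot a z t"
    and z1: "z (1/2) \<le> 0"
begin

text \<open>The derivative is built first and integrated afterwards, which makes the extension
  continuously differentiable. Since \<open>z (1/2) \<le> 0\<close>, the slope is \<open>0\<close>
  at the middle and the two halves fit together there.\<close>

lemma even_extension_exists: "\<exists>U G. even_extension z U G"
proof -
  define clip where "clip t = max 0 (min (1/2) t)" for t :: real
  have clip: "clip t \<in> {0..1/2}" for t by (auto simp: clip_def max_def min_def)
  have clip_mono: "clip s \<le> clip t" if "s \<le> t" for s t using that by (auto simp: clip_def max_def min_def)
  \<comment> \<open>On \<open>[0, 1/2]\<close> the reflected argument is clipped to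
    \<open>1/2\<close>, where the slope vanishes; antisymmetry about \<open>1/2\<close> is built in.
    To the left of \<open>0\<close> the value is constantly the initial slope, so that
    \<open>U\<close> is negative there.\<close>
  define G where "G t = slope z (clip t) - slope z (clip (1 - t))" for t
  have cont: "continuous_on UNIV (\<lambda>t. slope z (clip (c t)))" if "continuous_on UNIV c" for c
    by (rule continuous_on_compose2[OF continuous_on_slope[OF z]])
      (use clip in \<open>auto simp: clip_def intro!: continuous_intros that simp del: max.bounded_iff\<close>)
  have cG: "continuous_on UNIV G"
    unfolding G_def[abs_def] by (intro continuous_intros cont)
  have s1: "slope z (1/2) = 0" using z1 p by (simp add: slope_def max_def)
  have G_eq: "G t = slope z t" if "0 \<le> t" "t \<le> 1/2" for t
  proof -
    have c: "clip t = t" "clip (1 - t) = 1/2" using that by (auto simp: clip_def)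
    show ?thesis unfolding G_def c s1 by simp
  qed
  have G_sym: "G (1 - t) = - G t" for t by (simp add: G_def)
  have sl: "slope z (clip t) \<le> slope z (clip s)" if "s \<le> t" for s t
    using clip clip_mono[OF that] by (intro slope_antimono[OF a z zeq]) auto
  have G_anti: "G t \<le> G s" if "s \<le> t" for s t
    using sl[of s t] sl[of "1 - t" "1 - s"] that by (simp add: G_def)
  obtain U where dU: "\<And>x. (U has_real_derivative G x) (at x)" and U: "\<And>t. 0 \<le> t \<Longrightarrow> U t = integral {0..t} G"
    using antiderivative[OF cG] by blast
  have U_eq: "U t = height z t" if "0 \<le> t" "t \<le> 1/2" for t
    unfolding U[OF that(1)] height_def using that by (intro integral_cong G_eq) auto
  have U_sym: "U (1 - t) = U t" for t
    using antisymmetric_if_symmetric_derivative[OF dU, of "-1" t] G_sym by simp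
  have pos: "0 < U t" if "0 < t" "t \<le> 1/2" for t
    using height_pos[OF a z zeq that] U_eq that by simp
  have neg: "U t \<le> 0" if "t \<le> 0" for t
  proof -
    have "U t \<le> U 0"
    proof (rule DERIV_nonneg_imp_nondecreasing[OF that])
      fix x :: real assume "x \<le> 0"
      then have "0 \<le> G x" using G_anti[of x 0] G_eq[of 0] order_trans[OF slope_nonneg] by simp
      then show "\<exists>y. (U has_real_derivative y) (at x) \<and> 0 \<le> y" using dU by blast
    qed
    then show ?thesis using U[of 0] by simp
  qed
  have "if t \<in> {0<..<1} then 0 < U t else U t \<le> 0" for t
    using pos[of t] pos[of "1 - t"] neg[of t] neg[of "1 - t"] U_sym[of t] by (cases "t \<le> 1/2") auto
  then show ?thesis
    unfolding even_extension_def using dU cG U_eq G_eq U_sym G_sym G_anti by blast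
qed

lemma even_extension_norm:
  assumes E: "even_extension z U G"
  shows "W01p_norm p U = amplitude z"
proof -
  note dU = even_extensionD(1)[OF E] and cG = even_extensionD(2)[OF E] and G = even_extensionD(5,7)[OF E]
    and U = even_extensionD(9,10)[OF E]
  have "integral {0..1} (\<lambda>t. \<bar>G t\<bar> powr p) = 2 * integral {0..1/2} (\<lambda>t. \<bar>G t\<bar> powr p)"
    using G(2) p by (intro integral_symmetric continuous_on_abs_powr cG) auto
  also have "integral {0..1/2} (\<lambda>t. \<bar>G t\<bar> powr p) = integral {0..1/2} (\<lambda>t. slope z t powr p)"
    by (intro integral_cong) (simp add: G(1))
  finally show ?thesis using hump_W01p(3)[OF dU cG U p] by (simp add: amplitude_def)
qed

text \<open>Suppose \<open>M = height z (1/2) \<le> r\<close>. The energy identity, with a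
  nonpositive boundary term, gives \<open>N powr p \<le> F M 0 * (C * N)\<close>, the integral of
  \<open>U\<close> being controlled by the Poincare constant \<open>C\<close>. Scaling from
  \<open>r\<close> down to \<open>M\<close> and (H2) then yield
  \<open>N powr (p - 1) < M powr (p - 1)\<close>, against \<open>M \<le> N\<close>.\<close>

lemma height_greater:
  assumes r: "0 < r" "F r 0 < r powr (p - 1) / poincare_const p"
  shows "r < height z (1/2)"
proof (rule ccontr)
  assume "\<not> r < height z (1/2)"
  define M where "M = height z (1/2)"
  define N where "N = amplitude z"
  define C where "C = poincare_const p"
  have M: "0 < M" "M \<le> r" "M \<le> N"
    using \<open>\<not> r < height z (1/2)\<close> height_pos[OF a z zeq, of "1/2"] height_le_amplitude[OF a z zeq]
    by (simp_all add: M_def N_def)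
  \<comment> \<open>A nonpositive \<open>C\<close> would make the quotient in (H2) nonpositive, also
    for \<open>C = 0\<close> as division by zero gives \<open>0\<close>, whereas
    \<open>F r 0\<close> is nonnegative.\<close>
  have C: "0 < C" using r F_nonneg[of r 0] unfolding C_def by (smt (verit) divide_nonneg_nonpos powr_ge_zero)
  obtain U G where E: "even_extension z U G" using even_extension_exists by blast
  note dU = even_extensionD(1)[OF E] and cG = even_extensionD(2)[OF E] and cU = even_extensionD(3)[OF E]
    and U_eq = even_extensionD(4)[OF E] and U_sym = even_extensionD(6)[OF E] and U = even_extensionD(9,10)[OF E]
  have W: "U \<in> W01p p" by (rule hump_W01p[OF dU cG U p])
  have norm: "W01p_norm p U = N" unfolding N_def by (rule even_extension_norm[OF E])
  have hi: "height z integrable_on {0..1/2}" by (intro integrable_continuous_real continuous_on_height z)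
  have "integral {0..1/2} (height z) = integral {0..1/2} U"
    by (intro integral_cong) (simp add: U_eq)
  then have "2 * integral {0..1/2} (height z) = integral {0..1} U"
    using integral_symmetric[OF cU U_sym] by simp
  also have "\<dots> = (LINT x|I01. U x)" by (rule continuous_I01(2)[symmetric]) (rule continuous_on_subset[OF cU], simp)
  also have "\<dots> = (LINT x|I01. \<bar>U x\<bar>)"
    using U(1) by (intro Bochner_Integration.integral_cong) force+
  also have "\<dots> \<le> Lp_norm p U" by (rule Lp_integral_le_norm[OF W01p_D(1)[OF W] p])
  also have "\<dots> \<le> C * N"
    using poincare_const[OF p W _ W] M unfolding C_def norm by simp
  finally have int: "2 * integral {0..1/2} (height z) \<le> C * N" .
  have "N powr p \<le> 2 * integral {0..1/2} (\<lambda>t. rhs z t * height z t)"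
  proof -
    have "N powr p = 2 * integral {0..1/2} (\<lambda>t. slope z t powr p)"
      unfolding N_def by (rule amplitude_powr[OF a z zeq])
    also have "\<dots> = 2 * (z (1/2) * M + integral {0..1/2} (\<lambda>t. rhs z t * height z t))"
      by (simp only: energy_identity[OF a z zeq] M_def)
    also have "\<dots> \<le> 2 * (0 + integral {0..1/2} (\<lambda>t. rhs z t * height z t))"
      by (intro mult_left_mono add_right_mono mult_nonpos_nonneg z1 less_imp_le[OF M(1)]) simp
    finally show ?thesis by simp
  qed
  also have "\<dots> \<le> 2 * integral {0..1/2} (\<lambda>t. F M 0 * height z t)"
  proof (intro mult_left_mono integral_le rhs_height_integrable[OF a z zeq] integrable_on_mult_right hi)
    fix t :: real assume t: "t \<in> {0..1/2}"
    have "rhs z t \<le> F M 0"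
      using F_mono[OF height_mono[OF a z zeq, of t "1/2"], of "slope z t"]
        F_antimono[of 0 "slope z t" M] t by (simp add: M_def)
    then show "rhs z t * height z t \<le> F M 0 * height z t"
      using t height_nonneg[OF z, of t] by (intro mult_right_mono) auto
  qed auto
  also have "\<dots> = F M 0 * (2 * integral {0..1/2} (height z))" by simp
  also have "\<dots> \<le> F M 0 * (C * N)" by (intro mult_left_mono int F_nonneg)
  finally have "N * N powr (p - 1) \<le> N * (F M 0 * C)" using M by (simp add: powr_diff mult_ac)
  then have "N powr (p - 1) \<le> F M 0 * C" using M by simp
  also have "\<dots> \<le> (M / r) powr (p - 1) * F r 0 * C"
    using F_scale[of M r 1 0] M C by (intro mult_right_mono) auto
  also have "\<dots> < (M / r) powr (p - 1) * r powr (p - 1)"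
    using r C M unfolding mult.assoc C_def[symmetric] by (intro mult_strict_left_mono) (auto simp: less_divide_eq)
  also have "\<dots> = M powr (p - 1)" using M r by (simp add: powr_divide)
  also have "\<dots> \<le> N powr (p - 1)" using M p by (intro powr_mono2) auto
  finally show False by simp
qed

text \<open>The flux \<open>Z\<close> of the reflection is continuously differentiable with
  derivative \<open>- F (U x) \<bar>G x\<bar>\<close>, so one integration by parts against
  \<open>w\<close> proves the equation. The condition \<open>z (1/2) = 0\<close> makes
  \<open>Z\<close> odd about \<open>1/2\<close>, as the flux of an even function must be.\<close>

lemma weak_equation:
  assumes E: "even_extension z U G" and z0: "z (1/2) = 0" and w: "w \<in> W01p p"
  shows "duality_map p U w = (LINT x|I01. F (U x) \<bar>G x\<bar> * w x)"
proof -
  note dU = even_extensionD(1)[OF E] and cG = even_extensionD(2)[OF E] and cU = even_extensionD(3)[OF E]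
    and U_eq = even_extensionD(4)[OF E] and G = even_extensionD(5,7)[OF E] and U_sym = even_extensionD(6)[OF E]
  define h where "h t = F (U t) \<bar>G t\<bar>" for t
  have ch: "continuous_on UNIV h"
    unfolding h_def[abs_def] by (intro continuous_on_F cU continuous_on_rabs cG)
  obtain H where dH: "\<And>x. (H has_real_derivative h x) (at x)" and H: "\<And>t. 0 \<le> t \<Longrightarrow> H t = integral {0..t} h"
    using antiderivative[OF ch] by blast
  define Z where "Z t = a powr (p - 1) - H t" for t
  have Z_eq: "Z t = z t" if "0 \<le> t" "t \<le> 1/2" for t
  proof -
    have "integral {0..t} h = integral {0..t} (rhs z)"
      using that U_eq G(1) by (intro integral_cong) (simp add: h_def)
    then show ?thesis using zeq[OF that] H[OF that(1)] by (simp add: Z_def shoot_def)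
  qed
  have Z_sym: "Z (1 - t) = - Z t" for t
    using antisymmetric_if_symmetric_derivative[OF dH, of 1 t] Z_eq[of "1/2"] z0 U_sym G(2)
    by (simp add: h_def Z_def)
  \<comment> \<open>Since \<open>z\<close> is nonincreasing and ends at \<open>0\<close>, it is
    nonnegative on the half interval and the cut-off in \<open>slope\<close> is inactive.\<close>
  have half: "\<bar>G t\<bar> powr (p - 2) * G t = Z t" if "0 \<le> t" "t \<le> 1/2" for t
  proof -
    have zn: "0 \<le> z t" using z_antimono[OF a z zeq, of t "1/2"] z0 that by simp
    have "\<bar>G t\<bar> powr (p - 2) * G t = slope z t powr (p - 1)"
      using that G(1)[of t] powr_mult_base[OF slope_nonneg, of z t "p - 2"] by (simp add: mult.commute)
    also have "\<dots> = Z t" using zn p that by (simp add: Z_eq slope_def powr_powr)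
    finally show ?thesis .
  qed
  have GZ: "\<bar>G t\<bar> powr (p - 2) * G t = Z t" if "0 \<le> t" "t \<le> 1" for t
    using half[of t] half[of "1 - t"] that G(2)[of t] Z_sym[of t] by (cases "t \<le> 1/2") auto
  have wd: "has_weak_deriv U G" by (rule has_weak_deriv_C1[OF dU cG])
  have cZ: "continuous_on UNIV Z"
    unfolding Z_def[abs_def] using dH by (intro continuous_intros) (meson DERIV_isCont continuous_at_imp_continuous_on)
  have mw: "wderiv w \<in> borel_measurable I01" "wderiv U \<in> borel_measurable I01"
    using W01p_D(3)[OF w] wderiv(1)[OF wd] by (auto simp: Lp_def has_weak_deriv_def)
  have "duality_map p U w = (LINT x|I01. Z x * wderiv w x)"
    unfolding duality_map_def
  proof (rule integral_cong_AE)
    show "AE x in I01. \<bar>wderiv U x\<bar> powr (p - 2) * wderiv U x * wderiv w x = Z x * wderiv w x"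
      using wderiv(2)[OF wd] AE_space by eventually_elim (simp add: GZ)
  qed (use mw measurable_I01[OF cZ] in measurable)
  also have "\<dots> = - (LINT x|I01. - h x * w x)"
    by (rule W01p_integration_by_parts[OF w p]) (use DERIV_diff[OF DERIV_const dH] ch in
      \<open>auto simp: Z_def[abs_def] intro!: continuous_intros\<close>)
  finally show ?thesis by (simp add: h_def)
qed

lemma energy_identity_symmetric:
  assumes E: "even_extension z U G" and z0: "z (1/2) = 0"
  shows "integral {0..1} (\<lambda>t. F (U t) \<bar>G t\<bar> * U t) = amplitude z powr p"
proof -
  note cG = even_extensionD(2)[OF E] and cU = even_extensionD(3)[OF E] and U_eq = even_extensionD(4)[OF E]
    and G = even_extensionD(5,7)[OF E] and U_sym = even_extensionD(6)[OF E]
  have "integral {0..1} (\<lambda>t. F (U t) \<bar>G t\<bar> * U t) = 2 * integral {0..1/2} (\<lambda>t. F (U t) \<bar>G t\<bar> * U t)"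
    using U_sym G(2) by (intro integral_symmetric continuous_intros continuous_on_F cU cG) auto
  also have "integral {0..1/2} (\<lambda>t. F (U t) \<bar>G t\<bar> * U t) = integral {0..1/2} (\<lambda>t. rhs z t * height z t)"
    by (intro integral_cong) (simp add: U_eq G(1))
  finally show ?thesis by (simp add: amplitude_powr[OF a z zeq] energy_identity[OF a z zeq] z0)
qed

end

text \<open>This is the integrand of \<open>energy\<close>, with \<open>F\<close> for
  \<open>f\<close> and a continuous \<open>v'\<close> in place of the weak derivative.\<close>

definition ray_derivative :: "(real \<Rightarrow> real) \<Rightarrow> (real \<Rightarrow> real) \<Rightarrow> real \<Rightarrow> real" where
  "ray_derivative v v' s = s powr (p - 1) - integral {0..1} (\<lambda>x. F (s * v x) \<bar>s * v' x\<bar> * v x)"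

lemma ray_integrand_continuous:
  fixes v v' :: "real \<Rightarrow> real"
  assumes "continuous_on UNIV v" "continuous_on UNIV v'"
  shows "continuous_on UNIV (\<lambda>x. F (s * v x) \<bar>s * v' x\<bar> * v x)"
  by (intro continuous_intros continuous_on_F assms)

lemma continuous_on_ray_derivative:
  assumes v: "continuous_on UNIV v" "continuous_on UNIV v'"
  shows "continuous_on {0..} (ray_derivative v v')"
proof -
  have c: "continuous_on ({0..} \<times> {0..1}) (\<lambda>y. g (snd y))" if "continuous_on UNIV g" for g :: "real \<Rightarrow> real"
    by (rule continuous_on_compose2[OF that]) (auto intro!: continuous_intros)
  have "continuous_on ({0..} \<times> {0..1}) (\<lambda>(s, x). F (s * v x) \<bar>s * v' x\<bar> * v x)"
    unfolding split_beta by (intro continuous_intros continuous_on_F c v)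
  then have "continuous_on {0..} (\<lambda>s. integral (cbox 0 1) (\<lambda>x. F (s * v x) \<bar>s * v' x\<bar> * v x))"
    by (intro integral_continuous_on_param) simp
  then show ?thesis
    unfolding ray_derivative_def[abs_def] using p by (intro continuous_intros continuous_on_powr') auto
qed

lemma ray_integral_scale:
  fixes v v' :: "real \<Rightarrow> real"
  assumes v: "continuous_on UNIV v" "continuous_on UNIV v'" "\<And>x. x \<in> {0..1} \<Longrightarrow> 0 \<le> v x" and s: "0 < s" "s \<le> t"
  shows "integral {0..1} (\<lambda>x. F (s * v x) \<bar>s * v' x\<bar> * v x)
    \<le> (s / t) powr (p - 1) * integral {0..1} (\<lambda>x. F (t * v x) \<bar>t * v' x\<bar> * v x)"
proof -
  have i: "(\<lambda>x. F (s * v x) \<bar>s * v' x\<bar> * v x) integrable_on {0..1}" for s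
    by (rule integrable_continuous_real) (rule continuous_on_subset[OF ray_integrand_continuous[OF v(1,2)]], simp)
  have "integral {0..1} (\<lambda>x. F (s * v x) \<bar>s * v' x\<bar> * v x)
      \<le> integral {0..1} (\<lambda>x. (s / t) powr (p - 1) * (F (t * v x) \<bar>t * v' x\<bar> * v x))"
  proof (intro integral_le integrable_on_mult_right i)
    fix x :: real assume "x \<in> {0..1}"
    then have "0 \<le> v x" by (rule v(3))
    \<comment> \<open>At zeros of \<open>v\<close> both sides vanish; elsewhere
      \<open>F_scale\<close> applies, which asks for a positive first argument.\<close>
    then show "F (s * v x) \<bar>s * v' x\<bar> * v x \<le> (s / t) powr (p - 1) * (F (t * v x) \<bar>t * v' x\<bar> * v x)"
      using F_scale[OF s, of "v x" "\<bar>v' x\<bar>"] s mult_right_mono[of "F (s * v x) \<bar>s * v' x\<bar>" _ "v x"]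
      by (cases "v x = 0") (auto simp: abs_mult mult.assoc[symmetric])
  qed
  then show ?thesis by simp
qed

text \<open>Divided by \<open>s powr (p - 1)\<close>, the integral in \<open>ray_derivative\<close>
  is nondecreasing in \<open>s\<close>, and at \<open>N\<close> the quotient is \<open>1\<close>.
  Hence the ray derivative is nonnegative before \<open>N\<close> and nonpositive after it.\<close>

lemma ray_integral_max:
  assumes v: "continuous_on UNIV v" "continuous_on UNIV v'" "\<And>x. x \<in> {0..1} \<Longrightarrow> 0 \<le> v x"
    and N: "0 < N" "ray_derivative v v' N = 0" and t: "0 < t"
  shows "integral {0..t} (ray_derivative v v') \<le> integral {0..N} (ray_derivative v v')"
proof -
  let ?e = "ray_derivative v v'"
  have i: "?e integrable_on {b..c}" if "0 \<le> b" for b c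
    by (rule integrable_continuous_real, rule continuous_on_subset[OF continuous_on_ray_derivative[OF v(1,2)]])
       (use that in auto)
  have EN: "integral {0..1} (\<lambda>x. F (N * v x) \<bar>N * v' x\<bar> * v x) = N powr (p - 1)"
    using N(2) by (simp add: ray_derivative_def)
  show ?thesis
  proof (cases "t \<le> N")
    case True
    have "0 \<le> ?e s" if "s \<in> {t..N}" for s
      using ray_integral_scale[OF v, of s N] that t N EN
      by (simp add: ray_derivative_def powr_divide)
    then have "0 \<le> integral {t..N} ?e" using t by (intro integral_nonneg i) auto
    then show ?thesis
      using Henstock_Kurzweil_Integration.integral_combine[of 0 t N ?e] i True t by simp
  next
    case False
    have "?e s \<le> 0" if "s \<in> {N..t}" for s
    proof -
      have s: "0 < s" using that N by simp
      have "N powr (p - 1) \<le> (N / s) powr (p - 1) * integral {0..1} (\<lambda>x. F (s * v x) \<bar>s * v' x\<bar> * v x)"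
        using ray_integral_scale[OF v N(1), of s] that EN by simp
      then have "(s / N) powr (p - 1) * N powr (p - 1)
          \<le> (s / N) powr (p - 1) * ((N / s) powr (p - 1) * integral {0..1} (\<lambda>x. F (s * v x) \<bar>s * v' x\<bar> * v x))"
        by (intro mult_left_mono) auto
      then show ?thesis
        using s N(1) by (simp add: ray_derivative_def mult.assoc[symmetric] powr_mult[symmetric])
    qed
    then have "integral {N..t} ?e \<le> integral {N..t} (\<lambda>_. 0)"
      using N by (intro integral_le i) auto
    then show ?thesis
      using Henstock_Kurzweil_Integration.integral_combine[of 0 N t ?e] i False N by simp
  qed
qed

end

section \<open>Existence of a solution and maximality of its energy\<close>

lemma borel_measurable_continuous_pair:
  assumes F: "continuous_on UNIV (\<lambda>(x, y). F x y :: real)"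
    and "u \<in> borel_measurable M" "w \<in> borel_measurable M"
  shows "(\<lambda>x. F (u x :: real) (w x :: real)) \<in> borel_measurable M"
proof -
  have "(\<lambda>x. (u x, w x)) \<in> borel_measurable M" using assms by (intro borel_measurable_Pair)
  from measurable_compose[OF this borel_measurable_continuous_onI[OF F]] show ?thesis by simp
qed

text \<open>\<open>Lim\<close> carries information only once a limit is known to exist; here it is
  the infimum, to which a nonincreasing function bounded below converges.\<close>

lemma f_infty_le:
  assumes anti: "antimono_on {0..} (f x)" and nonneg: "\<And>y. 0 \<le> f x y" and y: "0 \<le> y"
  shows "f_infty f x \<le> f x y"
proof -
  define l where "l = Inf (f x ` {0..})"
  have bdd: "bdd_below (f x ` {0..})" using nonneg by (intro bdd_belowI[of _ 0]) auto
  have le: "l \<le> f x y" if "0 \<le> y" for y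
    unfolding l_def using that bdd by (intro cInf_lower) auto
  have "(f x \<longlongrightarrow> l) at_top"
  proof (rule decreasing_tendsto)
    show "\<forall>\<^sub>F y in at_top. l \<le> f x y"
      using eventually_ge_at_top[of 0] by eventually_elim (rule le)
    fix c assume "l < c"
    then obtain y0 where y0: "0 \<le> y0" "f x y0 < c"
      unfolding l_def using bdd by (subst (asm) cInf_less_iff) auto
    show "\<forall>\<^sub>F y in at_top. f x y < c"
      using eventually_ge_at_top[of y0]
    proof eventually_elim
      case (elim y)
      then have "f x y \<le> f x y0" using y0 by (intro monotone_onD[OF anti]) auto
      then show ?case using y0 by simp
    qed
  qed
  then have "f_infty f x = l" unfolding f_infty_def by (intro tendsto_Lim) auto
  then show ?thesis using le[OF y] by simp
qed

theorem theorem7: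
  fixes p r R \<beta> :: real and f :: "real \<Rightarrow> real \<Rightarrow> real"
  assumes p: "1 < p"
    and f_cont: "continuous_on ({0..} \<times> UNIV) (\<lambda>(x, y). f x y)"
    and f_nonneg: "\<And>x y. 0 \<le> x \<Longrightarrow> 0 \<le> f x y"
    and rR: "0 < r" "r < R"
    and H1_dec: "\<And>x. 0 \<le> x \<Longrightarrow> antimono_on {0..} (f x)"
    and H1_inc: "\<And>y. mono_on {0..} (\<lambda>x. f x y)"
    and H1_even: "\<And>x y. 0 \<le> x \<Longrightarrow> f x y = f x (- y)"
    and \<beta>: "0 < \<beta>" "\<beta> < 1 / 2"
    and H2_0: "f_zero f r < r powr (p - 1) / poincare_const p"
    and H2_infty: "f_infty f (R * phi p \<beta>) > R powr (p - 1) / (2 * integral {\<beta>..1/2} (phi p))"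
    and H3: "\<And>x y. 0 < x \<Longrightarrow>
               strict_mono_on {0<..R} (\<lambda>t. f (t * x) (t * y) / t powr (p - 1))"
  shows "\<exists>u\<in>coneK p. is_solution p f u \<and> r < W01p_norm p u \<and> W01p_norm p u < R \<and>
           (\<forall>t\<in>{r<..<R}. energy p f (\<lambda>x. u x / W01p_norm p u) t
              \<le> energy p f (\<lambda>x. u x / W01p_norm p u) (W01p_norm p u))"
proof -
  \<comment> \<open>Constant continuation to negative first arguments keeps continuity and
    monotonicity on the whole plane.\<close>
  define F where "F x y = f (max 0 x) y" for x y
  have f_scale: "f (s * x) (s * y) \<le> (s / t) powr (p - 1) * f (t * x) (t * y)"
    if "0 < s" "s \<le> t" "0 < x" for s t x y
  proof (cases "s = t")
    case False
    \<comment> \<open>(H3) is applied at the point \<open>(t * x / R, t * y / R)\<close> with the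
      parameters \<open>R * s / t\<close> and \<open>R\<close>, both within \<open>(0, R]\<close>
      whatever the size of \<open>t\<close>.\<close>
    have "f (R * s / t * (t * x / R)) (R * s / t * (t * y / R)) / (R * s / t) powr (p - 1)
        < f (R * (t * x / R)) (R * (t * y / R)) / R powr (p - 1)"
      using that False rR by (intro strict_mono_onD[OF H3]) (auto simp: field_simps)
    then have "f (s * x) (s * y) < (R * s / t) powr (p - 1) * f (t * x) (t * y) / R powr (p - 1)"
      using that rR by (simp add: divide_less_eq mult.commute)
    also have "\<dots> = (s / t) powr (p - 1) * f (t * x) (t * y)"
      using that rR by (simp add: powr_mult powr_divide)
    finally show ?thesis by simp
  qed (use that in simp)
  interpret shooting p F
  proof
    have "continuous_on UNIV (\<lambda>q. (\<lambda>(x, y). f x y) (max 0 (fst q), snd q))"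
      by (rule continuous_on_compose2[OF f_cont]) (auto intro!: continuous_intros)
    then show "continuous_on UNIV (\<lambda>(x, y). F x y)" by (simp add: F_def split_beta)
    show "F x y \<le> F x' y" if "x \<le> x'" for x x' y
      unfolding F_def using that by (intro monotone_onD[OF H1_inc]) auto
    show "F x y' \<le> F x y" if "0 \<le> y" "y \<le> y'" for x y y'
      unfolding F_def using that by (intro monotone_onD[OF H1_dec]) auto
    show "F (s * x) (s * y) \<le> (s / t) powr (p - 1) * F (t * x) (t * y)"
      if "0 < s" "s \<le> t" "0 < x" for s t x y
      using f_scale[OF that] that by (simp add: F_def)
  qed (use p f_nonneg in \<open>auto simp: F_def\<close>)
  \<comment> \<open>Evenness in the second argument lets the equation for the reflected function be
    stated with \<open>\<bar>G x\<bar>\<close>.\<close>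
  have fF: "f x y = F x \<bar>y\<bar>" if "0 \<le> x" for x y
    using that H1_even[of x y] by (simp add: F_def abs_if max_def)

  have \<phi>h: "0 < phi p (1/2)" using phi_pos[OF p, of "1/2"] by simp
  \<comment> \<open>At initial slope \<open>a1\<close> and with \<open>z (1/2) \<ge> 0\<close>, the
    lower bound through \<open>phi\<close> lifts the height at \<open>1/2\<close> to at least
    \<open>R\<close>. The maximum with \<open>r\<close> keeps the range of slopes nonempty.\<close>
  define a1 where "a1 = max r (R / phi p (1/2))"
  obtain a z where a: "r \<le> a" "a \<le> a1" and z: "continuous_on {0..1/2} z"
    and zeq: "\<And>t. 0 \<le> t \<Longrightarrow> t \<le> 1/2 \<Longrightarrow> z t = shoot a z t"
    and end1: "max 0 (z (1/2)) * (a1 - a) = 0" and end2: "min 0 (z (1/2)) * (a - r) = 0"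
    using shooting_limit[OF rR(1), of a1] by (auto simp: a1_def)
  have a0: "0 < a" using a rR by simp
  note traj = a0 z zeq
  define N where "N = amplitude z"
  have heightN: "height z (1/2) \<le> N" unfolding N_def by (rule height_le_amplitude[OF traj])
  have upper: "N < R" if "0 \<le> z (1/2)"
    unfolding N_def
  proof (rule amplitude_less[OF traj that _ \<beta>])
    have x: "0 \<le> R * phi p \<beta>" using rR phi_pos[OF p \<beta>(1)] \<beta> by simp
    show "f_infty f (R * phi p \<beta>) \<le> F (R * phi p \<beta>) y" if "0 \<le> y" for y
      using f_infty_le[of f "R * phi p \<beta>" y, OF H1_dec[OF x] f_nonneg[OF x] that] x by (simp add: F_def)
  qed (use rR H2_infty in auto)
  have "F r 0 = f r 0" using rR by (simp add: F_def)
  then have Fr: "F r 0 < r powr (p - 1) / poincare_const p" using H2_0 unfolding f_zero_def by argo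
  have lower: "r < height z (1/2)" if "z (1/2) \<le> 0" by (rule height_greater[OF traj that rR(1) Fr])
  \<comment> \<open>A positive end value forces \<open>a = a1\<close> and then
    \<open>R \<le> N\<close>, against \<open>upper\<close>; a negative one forces
    \<open>a = r\<close>, although \<open>r < N \<le> a\<close>.\<close>
  have z0: "z (1/2) = 0"
  proof (rule ccontr)
    assume "z (1/2) \<noteq> 0"
    then consider "0 < z (1/2)" | "z (1/2) < 0" by linarith
    then show False
    proof cases
      case 1
      then have "a = a1" using end1 by simp
      then have "R \<le> a * phi p (1/2)" using \<phi>h by (simp add: a1_def flip: pos_divide_le_eq)
      also have "\<dots> \<le> height z (1/2)" using height_lower[OF traj, of "1/2"] 1 by simp
      finally show False using upper 1 heightN by simp
    next
      case 2
      then have "a = r" using end2 by simp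
      then show False using lower 2 heightN amplitude_le[OF traj] by (simp add: N_def)
    qed
  qed
  have N: "r < N" "N < R" using lower upper z0 heightN by auto
  have N0: "0 < N" using N rR by simp

  have z0': "z (1/2) \<le> 0" using z0 by simp
  obtain U G where E: "even_extension z U G" using even_extension_exists[OF traj z0'] by blast
  note dU = even_extensionD(1)[OF E] and cG = even_extensionD(2)[OF E] and cU = even_extensionD(3)[OF E]
    and U_eq = even_extensionD(4)[OF E] and U_sym = even_extensionD(6)[OF E] and G_anti = even_extensionD(8)[OF E]
    and U = even_extensionD(9,10)[OF E]
  have W: "U \<in> W01p p" "AE x in I01. wderiv U x = G x"
    using hump_W01p(1,2)[OF dU cG U p] by auto
  have norm: "W01p_norm p U = N" unfolding N_def by (rule even_extension_norm[OF traj z0' E])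
  have U0: "U 0 = 0" using U_eq[of 0] by (simp add: height_def)
  then have U1: "U 1 = 0" using U_sym[of 0] by simp
  have U_nonneg: "0 \<le> U t" if "t \<in> {0..1}" for t
    using U(1)[of t] U0 U1 that by (cases "t = 0"; cases "t = 1") auto
  have mU: "U \<in> borel_measurable I01" "wderiv U \<in> borel_measurable I01"
    using W01p_D[OF W(1)] by (auto simp: Lp_def)

  have "convex_on {0..1} (\<lambda>x. - U x)"
    by (rule convex_on_realI[where f'="\<lambda>x. - G x"]) (auto intro!: derivative_eq_intros dU G_anti)
  then have cone: "U \<in> coneK p"
    unfolding coneK_def concave_on_def using W(1) U_nonneg U_sym U_eq
      height_lower_amplitude[OF traj] z0 by (auto simp: norm N_def)

  have "is_solution p f U"
    unfolding is_solution_def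
  proof (intro conjI ballI)
    fix w assume w: "w \<in> W01p p"
    note wD = W01p_D[OF w]
    have cF: "continuous_on UNIV (\<lambda>x. F (U x) \<bar>G x\<bar>)" by (intro continuous_on_F cU continuous_on_rabs cG)
    have ae: "AE x in I01. F (U x) \<bar>G x\<bar> * w x = f (U x) (wderiv U x) * w x"
      using W(2) AE_space by eventually_elim (simp add: fF U_nonneg)
    \<comment> \<open>Measurability is shown for \<open>F\<close>, which is continuous on the whole
      plane, and carried over to \<open>f\<close> on the interval, where \<open>U\<close> is
      nonnegative.\<close>
    have "(\<lambda>x. F (U x) \<bar>wderiv U x\<bar> * w x) \<in> borel_measurable I01"
      using mU wD(1) by (auto intro!: borel_measurable_times borel_measurable_continuous_pair[OF F_cont] simp: Lp_def)
    moreover have "(\<lambda>x. F (U x) \<bar>wderiv U x\<bar> * w x) \<in> borel_measurable I01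
        \<longleftrightarrow> (\<lambda>x. f (U x) (wderiv U x) * w x) \<in> borel_measurable I01"
      by (intro measurable_cong) (simp add: fF U_nonneg)
    ultimately have m: "(\<lambda>x. f (U x) (wderiv U x) * w x) \<in> borel_measurable I01" by simp
    have i: "integrable I01 (\<lambda>x. F (U x) \<bar>G x\<bar> * w x)"
      using integrable_mult_continuous[OF Lp_integrable[OF wD(1) p] _ measurable_I01[OF cF]]
        continuous_on_subset[OF cF] by (simp add: mult.commute)
    show "integrable I01 (\<lambda>x. f (U x) (wderiv U x) * w x)"
      by (rule integrable_cong_AE_imp[OF i m ae])
    show "duality_map p U w = (LINT x|I01. f (U x) (wderiv U x) * w x)"
      using weak_equation[OF traj z0' E z0 w] integral_cong_AE[OF borel_measurable_integrable[OF i] m ae] by simp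
  qed (use W(1) U_nonneg U0 U1 in auto)

  moreover have "energy p f (\<lambda>x. U x / N) t \<le> energy p f (\<lambda>x. U x / N) N" if t: "t \<in> {r<..<R}" for t
  proof -
    define v where "v x = U x / N" for x
    define v' where "v' x = G x / N" for x
    have cv: "continuous_on UNIV v" "continuous_on UNIV v'"
      unfolding v_def[abs_def] v'_def[abs_def] using N0 by (auto intro!: continuous_intros cU cG)
    have v_nonneg: "0 \<le> v x" if "x \<in> {0..1}" for x using U_nonneg[OF that] N0 by (simp add: v_def)
    have dv: "has_weak_deriv v v'"
      using cv(2) N0 by (intro has_weak_deriv_C1) (auto simp: v_def[abs_def] v'_def intro!: derivative_eq_intros dU)
    have mv: "v \<in> borel_measurable I01" "wderiv v \<in> borel_measurable I01"
      using wderiv(1)[OF dv] measurable_I01[OF cv(1)] by (auto simp: has_weak_deriv_def)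
    have inner: "(LINT x|I01. f (s * v x) (s * wderiv v x) * v x)
        = integral {0..1} (\<lambda>x. F (s * v x) \<bar>s * v' x\<bar> * v x)" if s: "0 \<le> s" for s
    proof -
      have c: "continuous_on UNIV (\<lambda>x. F (s * v x) \<bar>s * v' x\<bar> * v x)" by (rule ray_integrand_continuous[OF cv])
      have "(LINT x|I01. f (s * v x) (s * wderiv v x) * v x) = (LINT x|I01. F (s * v x) \<bar>s * wderiv v x\<bar> * v x)"
        by (rule Bochner_Integration.integral_cong) (simp_all add: fF s v_nonneg)
      also have "\<dots> = (LINT x|I01. F (s * v x) \<bar>s * v' x\<bar> * v x)"
      proof (rule integral_cong_AE)
        show "(\<lambda>x. F (s * v x) \<bar>s * wderiv v x\<bar> * v x) \<in> borel_measurable I01"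
          using mv by (auto intro!: borel_measurable_times borel_measurable_continuous_pair[OF F_cont])
        show "AE x in I01. F (s * v x) \<bar>s * wderiv v x\<bar> * v x = F (s * v x) \<bar>s * v' x\<bar> * v x"
          using wderiv(2)[OF dv] by eventually_elim simp
      qed (rule measurable_I01[OF c])
      also have "\<dots> = integral {0..1} (\<lambda>x. F (s * v x) \<bar>s * v' x\<bar> * v x)"
        by (rule continuous_I01(2)) (rule continuous_on_subset[OF c], simp)
      finally show ?thesis .
    qed
    have energy: "energy p f v t = integral {0..t} (ray_derivative v v')" for t
      unfolding energy_def by (intro integral_cong) (simp add: inner ray_derivative_def)
    \<comment> \<open>At \<open>s = N\<close> the ray passes through \<open>U\<close>, and the
      energy identity makes the derivative of the energy vanish there.\<close>
    have "integral {0..1} (\<lambda>x. F (N * v x) \<bar>N * v' x\<bar> * v x) = integral {0..1} (\<lambda>x. F (U x) \<bar>G x\<bar> * U x) / N"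
      using N0 by (simp add: v_def v'_def)
    also have "\<dots> = N powr p / N"
      unfolding N_def by (simp add: energy_identity_symmetric[OF traj z0' E z0])
    finally have "ray_derivative v v' N = 0" using N0 by (simp add: ray_derivative_def powr_diff)
    then have "energy p f v t \<le> energy p f v N"
      unfolding energy using t rR N0 by (intro ray_integral_max cv v_nonneg) auto
    then show ?thesis by (simp add: v_def[abs_def])
  qed
  ultimately show ?thesis
    using cone N by (intro bexI[of _ U]) (auto simp: norm)
qed

end
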